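(* Let $n\ge 2$, let $c_0,\dots,c_{n-1}\in\mathbb{R}$, and let $f(\lambda)=\lambda_1\cdots\lambda_n-\sum_{k=0}^{n-1}c_k\sigma_k(\lambda)$ on $\mathbb{R}^n$. Let $$r_f(x)=f(x,\dots,x)=x^n-\sum_{k=0}^{n-1}c_k\binom{n}{k}x^k .$$ Then $\{f>0\}$ has a connected component $\Gamma_f^n$ which is $\Upsilon$-stable if and only if $r_f$ is right-Noetherian. Moreover, $\Gamma_f^n$ is strictly $\Upsilon$-stable if and only if $r_f$ is strictly right-Noetherian.
   Context: $\sigma_k(\lambda)$ is the $k$-th elementary symmetric polynomial of $\lambda_1,\dots,\lambda_n$ ($\sigma_0=1$); $\Gamma_n=\{\lambda\in\mathbb{R}^n:\lambda_i>0\ \forall i\}$. A connected component $\Gamma_f^n$ of $\{f>0\}$ is $\Upsilon$-stable if $\Gamma_f^n\subseteq q+\Gamma_n$ for some $q\in\mathbb{R}^n$. Let $\Gamma_f^{n-1}$ be the projection of $\Gamma_f^n$ to $\mathbb{R}^{n-1}$ dropping the last coordinate and $\Upsilon_1=\{\mu\in\mathbb{R}^n:(\mu_{s(1)},\dots,\mu_{s(n-1)})\in\Gamma_f^{n-1}\ \forall s\in S_n\}$. $\Gamma_f^n$ is strictly $\Upsilon$-stable if it is $\Upsilon$-stable and $\partial\Gamma_f^n\subseteq\Upsilon_1$. A real univariate polynomial $p$ of degree $n$ is right-Noetherian if for every $k\in\{0,\dots,n-2\}$ there is a real root of $p^{(k)}$ that is greater than or equal to the largest real root of $p^{(k+1)}$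 ($p^{(k)}$ is the $k$-th derivative). It is strictly right-Noetherian if it is right-Noetherian and the largest real root of $p$ is strictly greater than the largest real root of $p'$. *)

theory Defs
  imports "HOL-Analysis.Analysis" "HOL-Computational_Algebra.Computational_Algebra"
begin

text \<open>
  Points of \<open>\<real>\<^sup>n\<close> are functions \<open>nat \<Rightarrow> real\<close> vanishing from index \<open>n\<close> on, i.e. the points of
  the library space \<^term>\<open>Euclidean_space n\<close>; the coordinates \<open>\<lambda>\<^sub>1, \<dots>, \<lambda>\<^sub>n\<close> are
  \<open>x 0, \<dots>, x (n - 1)\<close>. Boundaries and components are taken in this space.
\<close>

definition esym :: "nat \<Rightarrow> nat \<Rightarrow> (nat \<Rightarrow> real) \<Rightarrow> real" where
  "esym n k x = (\<Sum>S | S \<subseteq> {..<n} \<and> card S = k. \<Prod>i\<in>S. x i)"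

definition f_sigma :: "nat \<Rightarrow> (nat \<Rightarrow> real) \<Rightarrow> (nat \<Rightarrow> real) \<Rightarrow> real" where
  "f_sigma n c x = (\<Prod>i<n. x i) - (\<Sum>k<n. c k * esym n k x)"

definition diag_point :: "nat \<Rightarrow> real \<Rightarrow> nat \<Rightarrow> real" where
  "diag_point n t = (\<lambda>i. if i < n then t else 0)"

definition diag_restriction :: "nat \<Rightarrow> (nat \<Rightarrow> real) \<Rightarrow> real poly" where
  "diag_restriction n c = monom 1 n - (\<Sum>k<n. monom (c k * real (n choose k)) k)"

definition positive_components :: "nat \<Rightarrow> ((nat \<Rightarrow> real) \<Rightarrow> real) \<Rightarrow> (nat \<Rightarrow> real) set set" where
  "positive_components n f =
     connected_components_of (subtopology (Euclidean_space n) {x. f x > 0})"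

definition positive_orthant :: "nat \<Rightarrow> (nat \<Rightarrow> real) set" where
  "positive_orthant n = {x \<in> topspace (Euclidean_space n). \<forall>i<n. x i > 0}"

definition upsilon_stable :: "nat \<Rightarrow> (nat \<Rightarrow> real) set \<Rightarrow> bool" where
  "upsilon_stable n G \<longleftrightarrow>
     (\<exists>q \<in> topspace (Euclidean_space n). G \<subseteq> (\<lambda>x i. q i + x i) ` positive_orthant n)"

definition drop_last :: "nat \<Rightarrow> (nat \<Rightarrow> real) \<Rightarrow> nat \<Rightarrow> real" where
  "drop_last n x = (\<lambda>i. if i < n - 1 then x i else 0)"

definition upsilon_1 :: "nat \<Rightarrow> (nat \<Rightarrow> real) set \<Rightarrow> (nat \<Rightarrow> real) set" where
  "upsilon_1 n G =
     {x \<in> topspace (Euclidean_space n).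
        \<forall>s. s permutes {..<n} \<longrightarrow> drop_last n (\<lambda>i. x (s i)) \<in> drop_last n ` G}"

definition strictly_upsilon_stable :: "nat \<Rightarrow> (nat \<Rightarrow> real) set \<Rightarrow> bool" where
  "strictly_upsilon_stable n G \<longleftrightarrow>
     upsilon_stable n G \<and> Euclidean_space n frontier_of G \<subseteq> upsilon_1 n G"

definition is_largest_root :: "real poly \<Rightarrow> real \<Rightarrow> bool" where
  "is_largest_root p x \<longleftrightarrow> poly p x = 0 \<and> (\<forall>y. poly p y = 0 \<longrightarrow> y \<le> x)"

text \<open>
  The condition below includes the existence of a real root of \<open>p\<^sup>(\<^sup>k\<^sup>+\<^sup>1\<^sup>)\<close>. This
  costs nothing: \<open>p\<^sup>(\<^sup>n\<^sup>-\<^sup>1\<^sup>)\<close> is linear, and the condition for \<open>k + 1\<close> gives a root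
  of \<open>p\<^sup>(\<^sup>k\<^sup>+\<^sup>1\<^sup>)\<close>.
\<close>

definition right_noetherian :: "real poly \<Rightarrow> bool" where
  "right_noetherian p \<longleftrightarrow>
     (\<forall>k. k + 2 \<le> degree p \<longrightarrow>
        (\<exists>x y. poly ((pderiv ^^ k) p) x = 0 \<and>
               is_largest_root ((pderiv ^^ (k + 1)) p) y \<and> x \<ge> y))"

definition strictly_right_noetherian :: "real poly \<Rightarrow> bool" where
  "strictly_right_noetherian p \<longleftrightarrow>
     right_noetherian p \<and>
     (\<exists>x y. is_largest_root p x \<and> is_largest_root (pderiv p) y \<and> x > y)"

end

theory Submission
  imports Defs
begin

text \<open>
  Write \<open>f\<close> for \<open>f_sigma n c\<close> and \<open>r\<close> for its restriction to the diagonal. Then \<open>f\<close> is the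
  polarization of \<open>r\<close>: it is symmetric, affine in each variable, and \<open>f(t, \<dots>, t) = r(t)\<close>. Its
  partial derivatives \<open>\<partial>\<^sub>i f\<close> are polarizations of \<open>r' / n\<close> in the remaining variables, and so
  on. Hence the iterated derivatives of \<open>f\<close> are indexed by the sets \<open>S\<close> of remaining variables,
  and on the diagonal they give the Appell sequence \<open>p\<^sub>m\<close> with \<open>p\<^sub>n = r\<close> and \<open>p\<^sub>m' = m p\<^sub>m\<^sub>-\<^sub>1\<close>.

  Let \<open>C\<close> be the set where \<open>f\<close> and all its iterated mixed derivatives are positive. It is open and
  upward closed, so it is connected (join two points to their coordinatewise maximum), and the
  derivatives of order \<open>n - 1\<close>, which are \<open>\<lambda>\<^sub>i + e\<^sub>1\<close> for a constant \<open>e\<^sub>1\<close>, show that it lies in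
  a translate of the positive orthant. Conversely, on a stable component \<open>f\<close> must increase in
  every coordinate, since otherwise lowering that coordinate would keep \<open>f\<close> positive and leave
  every translate of the orthant; iterating this, all derivatives are positive, so the component
  is \<open>C\<close> (\<open>upsilon_stable_component_eq\<close>). A stable component therefore exists if and only if \<open>C\<close> is
  closed in \<open>{f > 0}\<close>, i.e. \<open>f\<close> vanishes on the boundary of \<open>C\<close> (\<open>vanishes_on_boundary\<close>).

  It remains to compare this boundary condition with the roots of the \<open>p\<^sub>m\<close>.

  \<^item> Suppose that the largest roots of the \<open>p\<^sub>m\<close> increase with \<open>m\<close>. By induction on the number
    \<open>m\<close> of variables of a derivative, again called \<open>f\<close>, the only way to violate the boundary
    condition is a boundary point of its cone where some \<open>g = \<partial>\<^sub>i f\<close> vanishes and \<open>f > 0\<close>. On a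
    level set of \<open>g\<close> with \<open>\<lambda>\<^sub>i\<close> held constant, replacing two different
    coordinates by a common value with the same \<open>g\<close> lowers the sum of the coordinates and does
    not lower \<open>f\<close> (\<open>smoothing_step\<close>). Minimizing the sum of the coordinates shows that \<open>f\<close> is at
    most its value at a point whose coordinates other than \<open>\<lambda>\<^sub>i\<close> are all equal
    (\<open>diagonal_maximizes_on_level_set\<close>), and for the level \<open>0\<close> that value is \<open>p\<^sub>m(y)\<close>, where \<open>y\<close>
    is the largest root of \<open>p\<^sub>m\<^sub>-\<^sub>1\<close> (\<open>polarization_le_appell_poly\<close>). The root condition says
    \<open>p\<^sub>m(y) \<le> 0\<close>.
  \<^item> Conversely, the boundary condition passes from \<open>f\<close> to \<open>\<partial>\<^sub>i f\<close>
    (\<open>vanishes_on_boundary_facet\<close>), by sending \<open>\<lambda>\<^sub>i\<close> to infinity. For each \<open>m\<close>, the diagonal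
    ray inside the cone starts at a point where \<open>p\<^sub>m\<close> vanishes and beyond which all lower
    \<open>p\<^sub>j\<close> are positive, so the largest roots increase.

  For strictness, the projection of \<open>C\<close> along the last coordinate is the analogous cone for
  \<open>\<partial>\<^sub>n f\<close>. Thus \<open>\<partial>C \<subseteq> \<Upsilon>\<^sub>1\<close> says that at the boundary points of \<open>C\<close> every derivative
  of \<open>f\<close> of positive order is positive. The diagonal boundary point shows that this needs a strict
  inequality between the two largest roots, and with \<open>p\<^sub>n(y) < 0\<close> the inequality above shows that
  this is enough.
\<close>

section \<open>Polarizations of univariate polynomials\<close>

text \<open>
  The coefficients are indexed by codegree. With this convention the derivative of
  \<open>polarization e A\<close> in a direction \<open>i \<in> A\<close> is \<open>polarization e (A - {i})\<close> with the same \<open>e\<close>, so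
  all iterated derivatives are the values \<open>polarization e S\<close> for \<open>S \<subseteq> A\<close>.
\<close>

definition polarization :: "(nat \<Rightarrow> real) \<Rightarrow> 'i set \<Rightarrow> ('i \<Rightarrow> real) \<Rightarrow> real" where
  "polarization e A x = (\<Sum>S\<in>Pow A. e (card (A - S)) * (\<Prod>i\<in>S. x i))"

lemma polarization_empty [simp]: "polarization e {} x = e 0"
  by (simp add: polarization_def)

lemma sum_Pow_insert:
  assumes "finite A" "a \<notin> A"
  shows "(\<Sum>S\<in>Pow (insert a A). g S) = (\<Sum>S\<in>Pow A. g S) + (\<Sum>S\<in>Pow A. g (insert a S))"
proof -
  have "inj_on (insert a) (Pow A)"
    using assms by (auto simp: inj_on_def)
  moreover have "Pow A \<inter> insert a ` Pow A = {}"
    using assms by auto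
  ultimately show ?thesis
    using assms by (simp add: Pow_insert sum.union_disjoint sum.reindex)
qed

text \<open>
  The constant term in the new variable is again a polarization, of the same degree as the slope
  but with shifted coefficients.
\<close>

lemma polarization_insert:
  assumes "finite A" "a \<notin> A"
  shows "polarization e (insert a A) x = x a * polarization e A x + polarization (e \<circ> Suc) A x"
proof -
  have "card (insert a A - S) = Suc (card (A - S))" if "S \<in> Pow A" for S
  proof -
    have "insert a A - S = insert a (A - S)" using that assms by auto
    then show ?thesis using assms by simp
  qed
  moreover have "e (card (insert a A - insert a S)) * prod x (insert a S)
      = x a * (e (card (A - S)) * prod x S)" if "S \<in> Pow A" for S
  proof -
    have "insert a A - insert a S = A - S" "finite S" "a \<notin> S"
      using that assms finite_subset by auto
    then show ?thesis by simp
  qed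
  ultimately show ?thesis
    unfolding polarization_def sum_Pow_insert[OF assms] sum_distrib_left
    by (simp add: add.commute)
qed

lemma polarization_singleton [simp]: "polarization e {i} x = e 0 * x i + e 1"
  using polarization_insert[of "{}" i e x] by (simp add: mult.commute)

lemma polarization_cong:
  assumes "\<And>i. i \<in> A \<Longrightarrow> x i = y i"
  shows "polarization e A x = polarization e A y"
  unfolding polarization_def
  by (intro sum.cong refl arg_cong2[of _ _ _ _ "(*)"] prod.cong) (use assms in auto)

lemma polarization_affine:
  assumes "finite A" "i \<in> A"
  shows "polarization e A (x(i := z)) = polarization e A x + (z - x i) * polarization e (A - {i}) x"
proof -
  have A: "A = insert i (A - {i})" "finite (A - {i})" "i \<notin> A - {i}" using assms by auto
  have eq: "polarization d (A - {i}) (x(i := z)) = polarization d (A - {i}) x" for d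
    by (rule polarization_cong) auto
  show ?thesis
    by (subst (1 2) A(1), subst (1 2) polarization_insert[OF A(2,3)])
      (simp add: eq algebra_simps)
qed

text \<open>
  Taylor expansion: a multi-affine function has no higher derivatives in a single variable.
\<close>

lemma polarization_add:
  assumes "finite A"
  shows "polarization e A (\<lambda>i. x i + d i) = (\<Sum>S\<in>Pow A. polarization e S x * (\<Prod>i\<in>A - S. d i))"
  using assms
proof (induction A arbitrary: e rule: finite_induct)
  case empty
  then show ?case by simp
next
  case (insert a A)
  have "(\<Sum>S\<in>Pow A. polarization e S x * prod d (insert a A - S))
      = d a * polarization e A (\<lambda>i. x i + d i)"
    unfolding insert.IH sum_distrib_left
  proof (rule sum.cong)
    fix S assume "S \<in> Pow A"
    then have "insert a A - S = insert a (A - S)" using insert.hyps by auto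
    then show "polarization e S x * prod d (insert a A - S)
        = d a * (polarization e S x * prod d (A - S))"
      using insert.hyps by simp
  qed simp
  moreover have "(\<Sum>S\<in>Pow A. polarization e (insert a S) x * prod d (insert a A - insert a S))
      = x a * polarization e A (\<lambda>i. x i + d i) + polarization (e \<circ> Suc) A (\<lambda>i. x i + d i)"
    unfolding insert.IH sum_distrib_left sum.distrib[symmetric]
  proof (rule sum.cong)
    fix S assume "S \<in> Pow A"
    then have S: "finite S" "a \<notin> S" "insert a A - insert a S = A - S"
      using insert.hyps finite_subset by auto
    show "polarization e (insert a S) x * prod d (insert a A - insert a S)
      = x a * (polarization e S x * prod d (A - S)) + polarization (e \<circ> Suc) S x * prod d (A - S)"
      unfolding S(3) polarization_insert[OF S(1,2)] by (simp add: algebra_simps)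
  qed simp
  ultimately show ?case
    by (simp add: polarization_insert[OF insert.hyps] sum_Pow_insert[OF insert.hyps] algebra_simps)
qed

lemma polarization_reindex:
  assumes "inj_on s A" "finite A"
  shows "polarization e A (x \<circ> s) = polarization e (s ` A) x"
  using assms(2,1)
proof (induction A arbitrary: e rule: finite_induct)
  case (insert a A)
  then show ?case by (simp add: polarization_insert)
qed simp

lemma continuous_on_polarization [continuous_intros]:
  fixes x :: "'a::topological_space \<Rightarrow> 'i \<Rightarrow> real"
  assumes "\<And>i. i \<in> A \<Longrightarrow> continuous_on T (\<lambda>t. x t i)"
  shows "continuous_on T (\<lambda>t. polarization e A (x t))"
  unfolding polarization_def using assms
  by (auto intro!: continuous_intros)

lemma continuous_on_polarization_id [continuous_intros]:
  "continuous_on T (polarization e A)"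
  by (rule continuous_on_polarization[of A T "\<lambda>x. x"])
     (rule continuous_on_product_then_coordinatewise[OF continuous_on_id])

section \<open>Restriction to the diagonal\<close>

text \<open>
  The Appell sequence with coefficients \<open>e\<close>: the derivative of the member of degree \<open>m\<close> is \<open>m\<close>
  times the member of degree \<open>m - 1\<close>.
\<close>

definition appell_poly :: "(nat \<Rightarrow> real) \<Rightarrow> nat \<Rightarrow> real poly" where
  "appell_poly e m = (\<Sum>k\<le>m. monom (real (m choose k) * e (m - k)) k)"

lemma coeff_appell_poly:
  "coeff (appell_poly e m) k = (if k \<le> m then real (m choose k) * e (m - k) else 0)"
  by (simp add: appell_poly_def coeff_sum)

lemma poly_appell_poly:
  "poly (appell_poly e m) t = (\<Sum>k\<le>m. real (m choose k) * e (m - k) * t ^ k)"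
  by (simp add: appell_poly_def poly_sum poly_monom)

lemma pderiv_appell_poly:
  "pderiv (appell_poly e (Suc m)) = smult (real (Suc m)) (appell_poly e m)"
proof (rule poly_eqI)
  fix k
  have "real (Suc k) * real (Suc m choose Suc k) = real (Suc m) * real (m choose k)"
    using Suc_times_binomial[of k m] by (metis of_nat_mult)
  then show "coeff (pderiv (appell_poly e (Suc m))) k = coeff (smult (real (Suc m)) (appell_poly e m)) k"
    by (simp add: coeff_pderiv coeff_appell_poly del: binomial_Suc_Suc of_nat_Suc)
qed

lemma polarization_diagonal:
  assumes "finite A"
  shows "polarization e A (\<lambda>i. t) = poly (appell_poly e (card A)) t"
proof -
  have "polarization e A (\<lambda>i. t) = (\<Sum>S\<in>Pow A. e (card A - card S) * t ^ card S)"
    unfolding polarization_def using assms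
    by (intro sum.cong) (auto simp: card_Diff_subset finite_subset)
  also have "\<dots> = (\<Sum>k\<le>card A. \<Sum>S | S \<in> Pow A \<and> card S = k. e (card A - card S) * t ^ card S)"
    using assms by (intro sum.group[symmetric]) (auto simp: card_mono)
  also have "\<dots> = (\<Sum>k\<le>card A. \<Sum>S | S \<subseteq> A \<and> card S = k. e (card A - k) * t ^ k)"
    by (intro sum.cong) auto
  also have "\<dots> = poly (appell_poly e (card A)) t"
    using assms by (simp add: poly_appell_poly n_subsets mult.assoc)
  finally show ?thesis .
qed

section \<open>The cone of positive derivatives\<close>

definition pos_cone :: "(nat \<Rightarrow> real) \<Rightarrow> 'i set \<Rightarrow> ('i \<Rightarrow> real) set" where
  "pos_cone e A = {x. \<forall>S\<subseteq>A. polarization e S x > 0}"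

definition nonneg_cone :: "(nat \<Rightarrow> real) \<Rightarrow> 'i set \<Rightarrow> ('i \<Rightarrow> real) set" where
  "nonneg_cone e A = {x. \<forall>S\<subseteq>A. polarization e S x \<ge> 0}"

text \<open>
  For \<open>e 0 > 0\<close>, the boundary of the open cone consists of the points where all derivatives are
  nonnegative but not all are positive. The condition says that \<open>polarization e A\<close> is zero there, or equivalently that the
  cone is closed in the set where \<open>polarization e A\<close> is positive.
\<close>

definition vanishes_on_boundary :: "(nat \<Rightarrow> real) \<Rightarrow> 'i set \<Rightarrow> bool" where
  "vanishes_on_boundary e A \<longleftrightarrow>
     (\<forall>x \<in> nonneg_cone e A. polarization e A x > 0 \<longrightarrow> x \<in> pos_cone e A)"

lemma pos_cone_subset_nonneg_cone: "pos_cone e A \<subseteq> nonneg_cone e A"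
  by (auto simp: pos_cone_def nonneg_cone_def intro: less_imp_le)

lemma open_pos_cone:
  assumes "finite A"
  shows "open (pos_cone e A)"
proof -
  have "pos_cone e A = (\<Inter>S\<in>Pow A. {x. 0 < polarization e S x})"
    by (auto simp: pos_cone_def)
  moreover have "open {x. 0 < polarization e S x}" for S
    by (intro open_Collect_less continuous_intros)
  ultimately show ?thesis
    using assms by (metis open_INT finite_Pow_iff)
qed

lemma closed_nonneg_cone: "closed (nonneg_cone e A)"
proof -
  have "nonneg_cone e A = (\<Inter>S\<in>Pow A. {x. 0 \<le> polarization e S x})"
    by (auto simp: nonneg_cone_def)
  moreover have "closed {x. 0 \<le> polarization e S x}" for S
    by (intro closed_Collect_le continuous_intros)
  ultimately show ?thesis
    by (metis closed_INT)
qed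

text \<open>
  All terms of the Taylor expansion are nonnegative, so the sum is at least each of its terms. The
  two bounds come from the terms of order zero and of top order.
\<close>

lemma nonneg_cone_mono:
  assumes "finite A" "e 0 \<ge> 0" "x \<in> nonneg_cone e A" "S \<subseteq> A" "\<And>i. i \<in> A \<Longrightarrow> x i \<le> y i"
  shows "polarization e S x \<le> polarization e S y"
    and "e 0 * (\<Prod>i\<in>S. y i - x i) \<le> polarization e S y"
proof -
  define d where "d = (\<lambda>i. y i - x i)"
  have fin: "finite S" using assms finite_subset by blast
  have y: "polarization e S y = (\<Sum>T\<in>Pow S. polarization e T x * (\<Prod>i\<in>S - T. d i))"
    using polarization_add[OF fin, of e x d] by (simp add: d_def)
  have nn: "0 \<le> polarization e T x * (\<Prod>i\<in>S - T. d i)" if "T \<in> Pow S" for T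
    using that assms by (intro mult_nonneg_nonneg prod_nonneg) (auto simp: nonneg_cone_def d_def)
  have le: "polarization e T x * (\<Prod>i\<in>S - T. d i) \<le> polarization e S y" if "T \<in> Pow S" for T
    unfolding y using that nn fin by (intro member_le_sum) auto
  show "polarization e S x \<le> polarization e S y"
    using le[of S] by simp
  show "e 0 * (\<Prod>i\<in>S. y i - x i) \<le> polarization e S y"
    using le[of "{}"] by (simp add: d_def)
qed

lemma pos_cone_upward:
  assumes "finite A" "e 0 \<ge> 0" "x \<in> pos_cone e A" "\<And>i. i \<in> A \<Longrightarrow> x i \<le> y i"
  shows "y \<in> pos_cone e A"
proof -
  have "x \<in> nonneg_cone e A" using assms(3) pos_cone_subset_nonneg_cone by auto
  have "0 < polarization e S y" if "S \<subseteq> A" for S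
  proof -
    have "0 < polarization e S x" using assms(3) that unfolding pos_cone_def by blast
    also have "\<dots> \<le> polarization e S y"
      by (rule nonneg_cone_mono(1)[OF assms(1,2) \<open>x \<in> nonneg_cone e A\<close> that assms(4)])
    finally show ?thesis .
  qed
  then show ?thesis unfolding pos_cone_def by blast
qed

lemma nonneg_cone_shift:
  assumes "finite A" "e 0 > 0" "x \<in> nonneg_cone e A" "\<And>i. i \<in> A \<Longrightarrow> x i < y i"
  shows "y \<in> pos_cone e A"
proof -
  have "0 < polarization e S y" if "S \<subseteq> A" for S
  proof -
    have "0 < e 0 * (\<Prod>i\<in>S. y i - x i)"
      using assms that by (intro mult_pos_pos prod_pos) auto
    also have "\<dots> \<le> polarization e S y"
      using assms that by (intro nonneg_cone_mono(2)[of A]) (auto intro: less_imp_le)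
    finally show ?thesis .
  qed
  then show ?thesis by (auto simp: pos_cone_def)
qed

text \<open>
  Under the boundary condition the cone is open and closed in the set where the polarization is
  positive.
\<close>

lemma pos_cone_absorbs_connected:
  assumes "finite A" "vanishes_on_boundary e A" "connected T"
    and "\<And>x. x \<in> T \<Longrightarrow> polarization e A x > 0" "x \<in> T" "x \<in> pos_cone e A"
  shows "T \<subseteq> pos_cone e A"
proof -
  have "pos_cone e A \<inter> T = {} \<or> - nonneg_cone e A \<inter> T = {}"
    using assms pos_cone_subset_nonneg_cone[of e A]
    by (intro connectedD[OF assms(3) open_pos_cone] open_Compl closed_nonneg_cone)
       (auto simp: vanishes_on_boundary_def)
  then show ?thesis
    using assms by (auto simp: vanishes_on_boundary_def)
qed

text \<open>
  Membership in the cone depends only on the coordinates in \<open>A\<close>, so continuity of those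
  coordinates suffices.
\<close>

lemma pos_cone_absorbs_path:
  fixes \<gamma> :: "real \<Rightarrow> 'i \<Rightarrow> real"
  assumes "finite A" "vanishes_on_boundary e A" "connected J"
    and "\<And>i. i \<in> A \<Longrightarrow> continuous_on J (\<lambda>t. \<gamma> t i)"
    and "\<And>t. t \<in> J \<Longrightarrow> polarization e A (\<gamma> t) > 0" "s \<in> J" "\<gamma> s \<in> pos_cone e A" "t \<in> J"
  shows "\<gamma> t \<in> pos_cone e A"
proof -
  \<comment> \<open>The coordinates outside the index set are reset to a constant to make the path continuous.\<close>
  define \<gamma>' where "\<gamma>' = (\<lambda>t i. if i \<in> A then \<gamma> t i else 0)"
  have eq: "polarization e S (\<gamma>' t) = polarization e S (\<gamma> t)" if "S \<subseteq> A" for S t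
    by (rule polarization_cong) (use that in \<open>auto simp: \<gamma>'_def\<close>)
  then have cone: "\<gamma>' t \<in> pos_cone e A \<longleftrightarrow> \<gamma> t \<in> pos_cone e A" for t
    by (simp add: pos_cone_def)
  have "continuous_on J (\<lambda>t. \<gamma>' t i)" for i
    using assms(4) by (cases "i \<in> A") (simp_all add: \<gamma>'_def)
  then have "connected (\<gamma>' ` J)"
    using assms(3) by (intro connected_continuous_image continuous_on_coordinatewise_then_product)
  then have "\<gamma>' ` J \<subseteq> pos_cone e A"
    using assms cone eq by (intro pos_cone_absorbs_connected[where x = "\<gamma>' s"]) auto
  then show ?thesis using assms cone by auto
qed

lemma continuous_on_coordinate:
  fixes i :: 'i
  shows "continuous_on T (\<lambda>x::'i \<Rightarrow> real. x i)"
  by (rule continuous_on_product_then_coordinatewise[OF continuous_on_id])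

section \<open>Smoothing on level sets\<close>

lemma polarization_two:
  assumes "finite C" "j \<notin> C" "k \<notin> C" "j \<noteq> k"
  shows "polarization e (insert j (insert k C)) x = polarization e C x * (x j * x k)
     + polarization (e \<circ> Suc) C x * (x j + x k) + polarization (e \<circ> Suc \<circ> Suc) C x"
  using assms by (simp add: polarization_insert algebra_simps)

text \<open>
  In the two coordinates \<open>p = y j\<close> and \<open>q = y k\<close> the polarization is \<open>a p q + b (p + q) + c\<close>, and
  the one with shifted coefficients is \<open>b p q + c (p + q) + d\<close>. A level set of the first is a
  branch of the hyperbola on which \<open>(a p + b) (a q + b)\<close> is constant. On it the second function is
  affine in \<open>p + q\<close> with slope \<open>(a c - b\<^sup>2) / a\<close>. Since \<open>p + q\<close> is smallest at the vertex \<open>p = q\<close>,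
  sliding to the vertex does not lower the second function once \<open>a c \<le> b\<^sup>2\<close> is known.
\<close>

lemma smoothing_step:
  assumes "finite B" "vanishes_on_boundary e B" "y \<in> pos_cone e B"
    and jk: "j \<in> B" "k \<in> B" "y j \<noteq> y k"
  obtains z where "z \<in> pos_cone e B" "polarization e B z = polarization e B y"
    "polarization (e \<circ> Suc) B y \<le> polarization (e \<circ> Suc) B z"
    "sum z B < sum y B" "\<And>i. i \<notin> B \<Longrightarrow> z i = y i"
proof -
  define C where "C = B - {j, k}"
  have C: "finite C" "j \<notin> C" "k \<notin> C" "j \<noteq> k" "B = insert j (insert k C)"
    using assms by (auto simp: C_def)
  define a b c d where "a = polarization e C y" and "b = polarization (e \<circ> Suc) C y"
    and "c = polarization (e \<circ> Suc \<circ> Suc) C y" and "d = polarization (e \<circ> Suc \<circ> Suc \<circ> Suc) C y"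
  define Y where "Y = (\<lambda>p q. y(j := p, k := q))"
  have cong: "polarization f C (Y p q) = polarization f C y" for f p q
    by (rule polarization_cong) (use C in \<open>auto simp: Y_def\<close>)
  have Yjk [simp]: "Y p q j = p" "Y p q k = q" for p q
    using C by (auto simp: Y_def)
  have Y0: "Y (y j) (y k) = y" by (auto simp: Y_def)
  have f: "polarization e B (Y p q) = a * (p * q) + b * (p + q) + c" for p q
    unfolding C(5) polarization_two[OF C(1-4)] by (simp add: cong a_def b_def c_def)
  have h: "polarization (e \<circ> Suc) B (Y p q) = b * (p * q) + c * (p + q) + d" for p q
    unfolding C(5) polarization_two[OF C(1-4)] by (simp add: cong b_def c_def d_def)
  have fk: "polarization e (insert j C) (Y p q) = a * p + b" for p q
    using C by (simp add: polarization_insert cong a_def b_def)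
  have fj: "polarization e (insert k C) (Y p q) = a * q + b" for p q
    using C by (simp add: polarization_insert cong a_def b_def)
  define u v \<epsilon> where "u = a * y j + b" and "v = a * y k + b" and "\<epsilon> = polarization e B y"
  have \<epsilon>: "\<epsilon> = a * (y j * y k) + b * (y j + y k) + c"
    using f[of "y j" "y k"] by (simp add: Y0 \<epsilon>_def)
  have pos: "a > 0" "u > 0" "v > 0" "\<epsilon> > 0"
  proof -
    have "polarization e S y > 0" if "S \<subseteq> B" for S
      using assms(3) that by (auto simp: pos_cone_def)
    from this[of C] this[of B] this[of "insert j C"] this[of "insert k C"]
    show "a > 0" "u > 0" "v > 0" "\<epsilon> > 0"
      using fk[of "y j" "y k"] fj[of "y j" "y k"] C(5)
      by (auto simp: Y0 a_def u_def v_def \<epsilon>_def)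
  qed
  have uv: "u * v = b\<^sup>2 - a * c + a * \<epsilon>"
    by (simp add: \<epsilon> u_def v_def power2_eq_square algebra_simps)
  \<comment> \<open>This is the inequality \<open>a c \<le> b\<^sup>2\<close>. Lowering \<open>y j\<close> keeps the point in the cone until the
    polarization reaches zero at \<open>y j - \<epsilon> / v\<close>, so the derivative \<open>a (y j) + b\<close> cannot reach zero
    before, which it would do at \<open>y j - u / a\<close>.\<close>
  have "a * \<epsilon> \<le> u * v"
  proof (rule ccontr)
    assume "\<not> a * \<epsilon> \<le> u * v"
    then have small: "u / a < \<epsilon> / v"
      using pos by (simp add: field_simps)
    have "Y (y j - u / a) (y k) \<in> pos_cone e B"
    proof (rule pos_cone_absorbs_path[OF assms(1,2), of "{0..u / a}" "\<lambda>s. Y (y j - s) (y k)" 0])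
      fix s assume "s \<in> {0..u / a}"
      then have "s < \<epsilon> / v" using small by auto
      then have "s * v < \<epsilon>" using pos by (simp add: field_simps)
      moreover have "polarization e B (Y (y j - s) (y k)) = \<epsilon> - s * v"
        by (simp add: f \<epsilon> v_def algebra_simps)
      ultimately show "polarization e B (Y (y j - s) (y k)) > 0" by simp
    next
      fix i show "continuous_on {0..u / a} (\<lambda>t. Y (y j - t) (y k) i)"
        by (cases "i = j"; cases "i = k") (auto simp: Y_def intro!: continuous_intros)
    qed (use pos assms(3) Y0 in auto)
    then have "0 < polarization e (insert j C) (Y (y j - u / a) (y k))"
      using C(5) by (auto simp: pos_cone_def)
    then show False
      using pos by (simp add: fk u_def field_simps)
  qed
  then have disc: "a * c - b\<^sup>2 \<le> 0" using uv by simp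
  define w where "w = sqrt (u * v)"
  have w: "w > 0" "w * w = u * v" using pos by (simp_all add: w_def)
  have "u \<noteq> v" using jk pos by (auto simp: u_def v_def)
  have less: "2 * w < u + v"
  proof (rule power2_less_imp_less)
    have "0 < (u - v)\<^sup>2" using \<open>u \<noteq> v\<close> by simp
    then show "(2 * w)\<^sup>2 < (u + v)\<^sup>2"
      using w(2) by (simp add: power2_eq_square algebra_simps)
  qed (use pos in simp)
  have centre: "(w - b) / a + (w - b) / a < y j + y k"
  proof -
    have "(w - b) / a + (w - b) / a = (2 * w - 2 * b) / a" by (simp add: field_simps)
    also have "\<dots> < (u + v - 2 * b) / a"
      using less pos by (intro divide_strict_right_mono) auto
    also have "\<dots> = y j + y k" using pos by (simp add: u_def v_def field_simps)
    finally show ?thesis .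
  qed
  \<comment> \<open>The level set through \<open>y\<close>, parametrized by the factor \<open>r = a p + b\<close>; the vertex is at \<open>r = w\<close>.\<close>
  define \<gamma> where "\<gamma> = (\<lambda>r. Y ((r - b) / a) ((u * v / r - b) / a))"
  have \<gamma>f: "polarization e B (\<gamma> r) = \<epsilon>" if "r > 0" for r
  proof -
    have "a * polarization e B (\<gamma> r) = u * v - b\<^sup>2 + a * c"
      using that pos by (simp add: \<gamma>_def f field_simps power2_eq_square)
    then have "a * polarization e B (\<gamma> r) = a * \<epsilon>" using uv by simp
    then show ?thesis using pos by simp
  qed
  have \<gamma>u: "\<gamma> u = y"
    using pos Y0 by (simp add: \<gamma>_def u_def v_def)
  have \<gamma>w: "\<gamma> w = Y ((w - b) / a) ((w - b) / a)"
    using w(1) by (simp add: \<gamma>_def flip: w(2))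
  have "\<gamma> w \<in> pos_cone e B"
  proof (rule pos_cone_absorbs_path[OF assms(1,2), of "{min u w..max u w}" \<gamma> u])
    fix r assume "r \<in> {min u w..max u w}"
    then have "r > 0" using pos w by auto
    then show "polarization e B (\<gamma> r) > 0" using \<gamma>f pos by simp
  next
    fix i
    have "continuous_on {min u w..max u w} (\<lambda>r. (r - b) / a)"
      "continuous_on {min u w..max u w} (\<lambda>r. (u * v / r - b) / a)"
      using pos w by (auto intro!: continuous_intros)
    then show "continuous_on {min u w..max u w} (\<lambda>t. \<gamma> t i)"
      by (cases "i = j"; cases "i = k") (auto simp: \<gamma>_def Y_def)
  qed (use assms(3) \<gamma>u in auto)
  moreover have "polarization e B (\<gamma> w) = polarization e B y"
    using \<gamma>f[of w] w by (simp add: \<epsilon>_def)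
  moreover have "polarization (e \<circ> Suc) B y \<le> polarization (e \<circ> Suc) B (\<gamma> w)"
  proof -
    have hh: "a * polarization (e \<circ> Suc) B (Y p q) = b * (\<epsilon> - c) + (a * c - b\<^sup>2) * (p + q) + a * d"
      if "polarization e B (Y p q) = \<epsilon>" for p q
    proof -
      have "a * (p * q) = \<epsilon> - c - b * (p + q)" using that f[of p q] by simp
      then have "b * (a * (p * q)) = b * (\<epsilon> - c - b * (p + q))" by simp
      then show ?thesis by (simp add: h power2_eq_square algebra_simps)
    qed
    have "(a * c - b\<^sup>2) * (y j + y k) \<le> (a * c - b\<^sup>2) * ((w - b) / a + (w - b) / a)"
      using centre disc by (intro mult_left_mono_neg) auto
    then have "a * polarization (e \<circ> Suc) B y \<le> a * polarization (e \<circ> Suc) B (\<gamma> w)"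
      using hh[of "y j" "y k"] hh[of "(w - b) / a" "(w - b) / a"] \<gamma>f[of w] w(1) Y0 \<gamma>w
      by (simp add: \<epsilon>_def)
    then show ?thesis using pos by simp
  qed
  moreover have "sum (\<gamma> w) B < sum y B"
  proof -
    have "sum (\<gamma> w) C = sum y C"
      by (rule sum.cong) (use C in \<open>auto simp: \<gamma>_def Y_def\<close>)
    moreover have "(w - b) / a + (w - b) / a < y j + y k"
      by (rule centre)
    ultimately show ?thesis
      unfolding C(5) using C(1-4) by (simp add: \<gamma>w)
  qed
  moreover have "\<gamma> w i = y i" if "i \<notin> B" for i
    using that jk by (auto simp: \<gamma>_def Y_def)
  ultimately show ?thesis by (rule that)
qed

text \<open>
  Among the points of the cone with the same value of the polarization and at least the same value
  of the shifted one, a point with the smallest coordinate sum is on the diagonal, as otherwise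
  smoothing would improve it. Such a point exists because the derivatives that are affine in a
  single coordinate bound the coordinates below and the sum then bounds them above.
\<close>

lemma diagonal_maximizes_on_level_set:
  assumes "finite B" "B \<noteq> {}" "vanishes_on_boundary e B" "y \<in> pos_cone e B" "e 0 = 1"
  obtains t where "(\<lambda>i. t) \<in> pos_cone e B" "polarization e B (\<lambda>i. t) = polarization e B y"
    "polarization (e \<circ> Suc) B y \<le> polarization (e \<circ> Suc) B (\<lambda>i. t)"
proof -
  define U where "U = (\<Sum>i\<in>B. y i + e 1)"
  define box where "box = (\<Pi>\<^sub>E i\<in>UNIV. if i \<in> B then {- e 1..U - e 1} else {0::real})"
  define Z where "Z = nonneg_cone e B \<inter> {x. polarization e B x = polarization e B y}
    \<inter> {x. polarization (e \<circ> Suc) B y \<le> polarization (e \<circ> Suc) B x} \<inter> {x. sum x B \<le> sum y B}"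
  have "compact box"
    unfolding box_def compactin_euclidean_iff[symmetric] euclidean_product_topology[symmetric]
    by (subst compactin_PiE) auto
  moreover have "closed Z"
    unfolding Z_def
    by (intro closed_Int closed_nonneg_cone closed_Collect_eq closed_Collect_le continuous_on_sum
        continuous_on_const continuous_on_polarization_id continuous_on_coordinate)
  ultimately have "compact (box \<inter> Z)" by (rule compact_Int_closed)
  have in_box: "x \<in> box" if "x \<in> Z" "\<And>i. i \<notin> B \<Longrightarrow> x i = 0" for x
  proof -
    have lower: "0 \<le> x i + e 1" if "i \<in> B" for i
    proof -
      have "0 \<le> polarization e {i} x"
        using \<open>x \<in> Z\<close> that unfolding Z_def nonneg_cone_def by blast
      then show ?thesis using \<open>e 0 = 1\<close> by simp
    qed
    have upper: "x i + e 1 \<le> U" if "i \<in> B" for i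
    proof -
      have "x i + e 1 \<le> (\<Sum>i\<in>B. x i + e 1)"
        by (rule member_le_sum[OF that]) (use lower assms(1) in auto)
      also have "\<dots> \<le> U"
        using \<open>x \<in> Z\<close> by (simp add: Z_def U_def sum.distrib)
      finally show ?thesis .
    qed
    have "- e 1 \<le> x i \<and> x i \<le> U - e 1" if "i \<in> B" for i
      using lower[OF that] upper[OF that] by linarith
    then show ?thesis
      using that(2) by (auto simp: box_def PiE_def extensional_def)
  qed
  define y0 where "y0 = (\<lambda>i. if i \<in> B then y i else 0)"
  have "polarization f S y0 = polarization f S y" if "S \<subseteq> B" for f S
    by (rule polarization_cong) (use that in \<open>auto simp: y0_def\<close>)
  moreover have "sum y0 B = sum y B" by (simp add: y0_def)
  ultimately have "y0 \<in> Z"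
    using assms(4) by (auto simp: Z_def pos_cone_def nonneg_cone_def less_imp_le)
  then have "y0 \<in> box \<inter> Z" using in_box[of y0] by (simp add: y0_def)
  moreover have "continuous_on (box \<inter> Z) (\<lambda>x. sum x B)"
    by (intro continuous_on_sum continuous_on_coordinate)
  ultimately obtain z where z: "z \<in> box \<inter> Z" and min: "\<And>x. x \<in> box \<inter> Z \<Longrightarrow> sum z B \<le> sum x B"
    using continuous_attains_inf[OF \<open>compact (box \<inter> Z)\<close>, of "\<lambda>x. sum x B"] by blast
  have "polarization e B y > 0" using assms(4) by (auto simp: pos_cone_def)
  then have zpos: "z \<in> pos_cone e B"
    using z assms(3) by (auto simp: Z_def vanishes_on_boundary_def)
  have const: "z j = z k" if jk: "j \<in> B" "k \<in> B" for j k
  proof (rule ccontr)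
    assume "z j \<noteq> z k"
    then obtain x where x: "x \<in> pos_cone e B" "polarization e B x = polarization e B z"
      "polarization (e \<circ> Suc) B z \<le> polarization (e \<circ> Suc) B x"
      "sum x B < sum z B" "\<And>i. i \<notin> B \<Longrightarrow> x i = z i"
      using smoothing_step[OF assms(1,3) zpos jk] by blast
    have "x \<in> Z"
      using x z pos_cone_subset_nonneg_cone[of e B] by (auto simp: Z_def)
    moreover have "x i = 0" if "i \<notin> B" for i
      using x(5)[OF that] z that by (auto simp: box_def PiE_def Pi_def split: if_splits)
    ultimately have "x \<in> box \<inter> Z" using in_box by auto
    then show False using min[of x] x(4) by simp
  qed
  obtain j where "j \<in> B" using \<open>B \<noteq> {}\<close> by auto
  have eq: "polarization f S (\<lambda>i. z j) = polarization f S z" if "S \<subseteq> B" for f S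
    by (rule polarization_cong) (use const \<open>j \<in> B\<close> that in blast)
  show ?thesis
    by (rule that[of "z j"]) (use zpos z in \<open>auto simp: eq pos_cone_def Z_def\<close>)
qed

section \<open>The boundary inequality\<close>

lemma degree_appell_poly: "e 0 \<noteq> 0 \<Longrightarrow> degree (appell_poly e m) = m"
  by (intro antisym degree_le le_degree) (auto simp: coeff_appell_poly)

lemma appell_poly_pos:
  assumes "e 0 > 0" "is_largest_root (appell_poly e m) y" "y < t"
  shows "poly (appell_poly e m) t > 0"
proof (rule ccontr)
  assume "\<not> ?thesis"
  moreover have no_root: "poly (appell_poly e m) s \<noteq> 0" if "s \<ge> t" for s
    using assms that by (force simp: is_largest_root_def)
  ultimately have neg: "poly (appell_poly e m) t < 0"
    by (metis linorder_neqE_linordered_idom order_refl)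
  have lc: "lead_coeff (appell_poly e m) = e 0"
    using assms(1) by (simp add: degree_appell_poly coeff_appell_poly)
  then obtain r where r: "\<And>x. x \<ge> r \<Longrightarrow> e 0 \<le> poly (appell_poly e m) x"
    using poly_pinfty_gt_lc[of "appell_poly e m"] assms(1) by auto
  have "0 < poly (appell_poly e m) (max r t + 1)"
    using r[of "max r t + 1"] assms(1) by linarith
  then show False
    using poly_IVT_pos[OF _ neg, of "max r t + 1"] no_root by force
qed

lemma appell_poly_strict_mono:
  assumes "e 0 > 0" "is_largest_root (appell_poly e m) y" "y \<le> s" "s < t"
  shows "poly (appell_poly e (Suc m)) s < poly (appell_poly e (Suc m)) t"
proof -
  obtain r where "s < r" "poly (appell_poly e (Suc m)) t - poly (appell_poly e (Suc m)) s
      = (t - s) * (real (Suc m) * poly (appell_poly e m) r)"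
    using poly_MVT[OF assms(4), of "appell_poly e (Suc m)"]
    by (auto simp: pderiv_appell_poly simp del: of_nat_Suc)
  moreover have "0 < (t - s) * (real (Suc m) * poly (appell_poly e m) r)"
    using appell_poly_pos[OF assms(1,2), of r] \<open>s < r\<close> assms(3,4)
    by (intro mult_pos_pos) auto
  ultimately show ?thesis by linarith
qed

lemma appell_poly_mono:
  assumes "e 0 > 0" "is_largest_root (appell_poly e m) y" "y \<le> s" "s \<le> t"
  shows "poly (appell_poly e (Suc m)) s \<le> poly (appell_poly e (Suc m)) t"
  using appell_poly_strict_mono[OF assms(1-3), of t] assms(4) by (cases "s = t") auto

text \<open>
  The inequality that carries the proof. At a point of the open cone where \<open>polarization e B\<close> has
  the value \<open>\<epsilon> > 0\<close>, moving the coordinates in \<open>B\<close> to the diagonal point \<open>t\<close> of the same level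
  bounds \<open>polarization e (insert i B)\<close> by the Appell polynomial of degree \<open>card B + 1\<close> at \<open>t\<close>, up
  to a multiple of \<open>\<epsilon>\<close>. The given point has level \<open>0\<close> and is the limit of the points
  \<open>x + \<delta>\<close> of the open cone. As \<open>\<delta>\<close> tends to \<open>0\<close>, so does \<open>\<epsilon>\<close>, and \<open>t\<close> tends to \<open>y\<close>.
\<close>

lemma polarization_le_appell_poly:
  assumes "finite B" "i \<notin> B" "vanishes_on_boundary e B" "e 0 = 1"
    and root: "is_largest_root (appell_poly e (card B)) y"
    and x: "x \<in> nonneg_cone e B" "polarization e B x = 0"
  shows "polarization e (insert i B) x \<le> poly (appell_poly e (Suc (card B))) y"
proof -
  have "B \<noteq> {}" using x(2) assms(4) by auto
  let ?p = "appell_poly e (card B)" and ?q = "appell_poly e (Suc (card B))"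
  define X where "X = (\<lambda>\<delta> j. x j + \<delta>)"
  have diag: "polarization e B (\<lambda>i. t) = poly ?p t" for t
    by (rule polarization_diagonal[OF assms(1)])
  have cont: "((\<lambda>\<delta>. polarization e S (X \<delta>)) \<longlongrightarrow> polarization e S x) (at_right 0)" for S
  proof -
    have "continuous_on UNIV (\<lambda>\<delta>. polarization e S (X \<delta>))"
      by (intro continuous_on_polarization) (auto simp: X_def intro!: continuous_intros)
    then have "((\<lambda>\<delta>. polarization e S (X \<delta>)) \<longlongrightarrow> polarization e S (X 0)) (at_right 0)"
      by (simp add: continuous_on_eq_continuous_at isCont_def filterlim_at_split)
    then show ?thesis by (simp add: X_def)
  qed
  \<comment> \<open>It is enough to bound by the value at every \<open>s > y\<close>; then \<open>s\<close> tends to \<open>y\<close>.\<close>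
  have bound: "polarization e (insert i B) x \<le> poly ?q s" if "s > y" for s
  proof -
    have ps: "poly ?p s > 0" using appell_poly_pos[OF _ root that] assms(4) by simp
    have near: "polarization e (insert i B) (X \<delta>) \<le> (x i + \<delta> - y) * polarization e B (X \<delta>) + poly ?q s"
      if \<delta>: "\<delta> > 0" "polarization e B (X \<delta>) < poly ?p s" for \<delta>
    proof -
      have "X \<delta> \<in> pos_cone e B"
        by (rule nonneg_cone_shift[OF assms(1) _ x(1)]) (use \<delta> assms(4) in \<open>auto simp: X_def\<close>)
      then obtain t where t: "(\<lambda>i. t) \<in> pos_cone e B" "poly ?p t = polarization e B (X \<delta>)"
        "polarization (e \<circ> Suc) B (X \<delta>) \<le> polarization (e \<circ> Suc) B (\<lambda>i. t)"
        using diagonal_maximizes_on_level_set[OF assms(1) \<open>B \<noteq> {}\<close> assms(3) _ assms(4)]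
        unfolding diag by metis
      have pos: "poly ?p r > 0" if "(\<lambda>i. r) \<in> pos_cone e B" for r
        using that unfolding pos_cone_def diag[symmetric] by auto
      have "y < t"
      proof (rule ccontr)
        assume "\<not> y < t"
        then have "(\<lambda>i. y) \<in> pos_cone e B"
          using assms(4) by (intro pos_cone_upward[OF assms(1) _ t(1)]) auto
        then show False using pos root by (force simp: is_largest_root_def)
      qed
      have "t < s"
      proof (rule ccontr)
        assume ts: "\<not> t < s"
        have "(\<lambda>i. s) \<in> pos_cone e B"
        proof (rule pos_cone_absorbs_path[OF assms(1,3), of "{s..t}" "\<lambda>r i. r" t])
          fix r assume "r \<in> {s..t}"
          then show "polarization e B (\<lambda>i. r) > 0"
            unfolding diag using appell_poly_pos[OF _ root, of r] \<open>s > y\<close> assms(4) by auto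
        qed (use ts t in auto)
        then have "polarization e B (\<lambda>i. s) \<le> polarization e B (\<lambda>i. t)"
          using ts assms(4) pos_cone_subset_nonneg_cone[of e B]
          by (intro nonneg_cone_mono(1)[OF assms(1)]) auto
        then show False using t(2) \<delta> unfolding diag by simp
      qed
      have "polarization e (insert i B) (\<lambda>i. t) = t * poly ?p t + polarization (e \<circ> Suc) B (\<lambda>i. t)"
        using polarization_insert[OF assms(1,2)] by (simp add: diag)
      moreover have "polarization e (insert i B) (\<lambda>i. t) = poly ?q t"
        using polarization_diagonal[of "insert i B" e t] assms(1,2) by simp
      ultimately have "polarization e (insert i B) (X \<delta>)
          \<le> (x i + \<delta> - t) * polarization e B (X \<delta>) + poly ?q t"
        using t polarization_insert[OF assms(1,2), of e "X \<delta>"]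
        by (simp add: X_def algebra_simps)
      also have "\<dots> \<le> (x i + \<delta> - y) * polarization e B (X \<delta>) + poly ?q s"
        using \<open>y < t\<close> \<open>t < s\<close> pos[OF t(1)] t(2) assms(4)
        by (intro add_mono mult_right_mono appell_poly_mono[OF _ root]) auto
      finally show ?thesis .
    qed
    have "\<forall>\<^sub>F \<delta> in at_right 0. polarization e B (X \<delta>) < poly ?p s"
      using order_tendstoD(2)[OF cont[of B]] x(2) ps by simp
    moreover have "\<forall>\<^sub>F \<delta> in at_right (0::real). \<delta> > 0"
      by (simp add: eventually_at_right_less)
    ultimately have "\<forall>\<^sub>F \<delta> in at_right 0. polarization e (insert i B) (X \<delta>)
        \<le> (x i + \<delta> - y) * polarization e B (X \<delta>) + poly ?q s"
      by eventually_elim (use near in auto)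
    moreover have "((\<lambda>\<delta>. (x i + \<delta> - y) * polarization e B (X \<delta>) + poly ?q s)
        \<longlongrightarrow> (x i + 0 - y) * polarization e B x + poly ?q s) (at_right 0)"
      by (intro tendsto_intros cont)
    ultimately show ?thesis
      using tendsto_le[OF _ _ cont[of "insert i B"]] x(2) by simp
  qed
  have "((\<lambda>s. poly ?q s) \<longlongrightarrow> poly ?q y) (at_right y)"
    by (intro tendsto_intros)
  then show ?thesis
    by (rule tendsto_lowerbound)
       (auto intro: eventually_mono[OF eventually_at_right_less] bound)
qed

text \<open>
  The right-Noetherian condition for \<open>appell_poly e n\<close>, with its derivatives replaced by the
  proportional lower members of the Appell sequence.
\<close>

definition noetherian_chain :: "(nat \<Rightarrow> real) \<Rightarrow> nat \<Rightarrow> bool" where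
  "noetherian_chain e n \<longleftrightarrow> (\<forall>m. 1 \<le> m \<and> m < n \<longrightarrow>
     (\<exists>x y. poly (appell_poly e (Suc m)) x = 0 \<and> is_largest_root (appell_poly e m) y \<and> y \<le> x))"

text \<open>
  The polynomial increases to the right of the largest root of its derivative, so a root further
  to the right forces a nonpositive value there.
\<close>

lemma noetherian_chain_nonpos:
  assumes "noetherian_chain e n" "1 \<le> m" "m < n" "e 0 = 1"
  obtains y where "is_largest_root (appell_poly e m) y" "poly (appell_poly e (Suc m)) y \<le> 0"
proof -
  obtain x y where "poly (appell_poly e (Suc m)) x = 0" "is_largest_root (appell_poly e m) y" "y \<le> x"
    using assms by (auto simp: noetherian_chain_def)
  then show ?thesis
    using appell_poly_mono[of e m y y x] assms(4) that by auto
qed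

text \<open>
  Once all derivatives of first order are positive at a point, the induction hypothesis makes
  those of higher order positive as well. A first-order derivative that vanishes would make
  \<open>polarization e A\<close> nonpositive by the boundary inequality.
\<close>

lemma noetherian_chain_vanishes_on_boundary:
  assumes "noetherian_chain e n" "e 0 = 1" "finite A" "card A \<le> n"
  shows "vanishes_on_boundary e A"
  using assms(3,4)
proof (induction "card A" arbitrary: A)
  case 0
  then show ?case by (simp add: vanishes_on_boundary_def pos_cone_def)
next
  case (Suc m)
  have facet: "A = insert i (A - {i})" "finite (A - {i})" "card (A - {i}) = m"
    "vanishes_on_boundary e (A - {i})" if "i \<in> A" for i
    using Suc that by auto
  show ?case
    unfolding vanishes_on_boundary_def
  proof (intro ballI impI)
    fix x assume x: "x \<in> nonneg_cone e A" "polarization e A x > 0"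
    have pos: "polarization e (A - {i}) x > 0" if i: "i \<in> A" for i
    proof (rule ccontr)
      assume "\<not> ?thesis"
      moreover have nn: "x \<in> nonneg_cone e (A - {i})"
        using x(1) by (auto simp: nonneg_cone_def)
      moreover have "0 \<le> polarization e (A - {i}) x"
        using x(1) by (auto simp: nonneg_cone_def)
      ultimately have z: "polarization e (A - {i}) x = 0" by simp
      then have "A - {i} \<noteq> {}" using assms(2) by (metis polarization_empty zero_neq_one)
      then have "1 \<le> m" using facet[OF i] by (metis One_nat_def Suc_leI card_gt_0_iff)
      moreover have "m < n" using Suc by simp
      ultimately obtain y where y: "is_largest_root (appell_poly e m) y"
        "poly (appell_poly e (Suc m)) y \<le> 0"
        using noetherian_chain_nonpos[OF assms(1) _ _ assms(2)] by metis
      have "polarization e (insert i (A - {i})) x \<le> poly (appell_poly e (Suc m)) y"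
        using polarization_le_appell_poly[OF facet(2)[OF i] _ facet(4)[OF i] assms(2) _ nn z, of i y]
          y(1) facet(3)[OF i] by simp
      then show False using x(2) y(2) facet(1)[OF i] by simp
    qed
    have "polarization e S x > 0" if sub: "S \<subseteq> A" for S
    proof (cases "S = A")
      case False
      then obtain i where i: "i \<in> A" "S \<subseteq> A - {i}" using sub False by blast
      have "x \<in> nonneg_cone e (A - {i})"
        using x(1) by (auto simp: nonneg_cone_def)
      then have "x \<in> pos_cone e (A - {i})"
        using facet(4)[OF i(1)] pos[OF i(1)] by (auto simp: vanishes_on_boundary_def)
      then show ?thesis using i by (auto simp: pos_cone_def)
    qed (use x in auto)
    then show "x \<in> pos_cone e A" by (auto simp: pos_cone_def)
  qed
qed

section \<open>From the boundary condition back to the roots\<close>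

text \<open>
  Every derivative involving the new coordinate is affine in it with a positive slope, hence
  positive once the coordinate is large.
\<close>

lemma pos_cone_extend:
  assumes "finite B" "i \<notin> B" "y \<in> pos_cone e B"
  shows "\<forall>\<^sub>F z in at_top. y(i := z) \<in> pos_cone e (insert i B)"
proof -
  have "\<forall>\<^sub>F z in at_top. 0 < polarization e (insert i S) (y(i := z))" if "S \<in> Pow B" for S
  proof -
    have S: "finite S" "i \<notin> S" "0 < polarization e S y"
      using that assms finite_subset by (auto simp: pos_cone_def)
    have eq: "polarization f S (y(i := z)) = polarization f S y" for f z
      by (rule polarization_cong) (use S in auto)
    have "\<forall>\<^sub>F z in at_top. - polarization (e \<circ> Suc) S y / polarization e S y < z"
      by (rule eventually_gt_at_top)
    then show ?thesis
      by eventually_elim (use S in \<open>simp add: polarization_insert eq field_simps\<close>)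
  qed
  then have "\<forall>\<^sub>F z in at_top. \<forall>S\<in>Pow B. 0 < polarization e (insert i S) (y(i := z))"
    using assms(1) by (intro eventually_ball_finite) auto
  then show ?thesis
  proof eventually_elim
    case (elim z)
    have "0 < polarization e S (y(i := z))" if "S \<subseteq> insert i B" for S
    proof (cases "i \<in> S")
      case True
      then have "insert i (S - {i}) = S" "S - {i} \<in> Pow B" using that by auto
      then show ?thesis using elim by metis
    next
      case False
      then have "polarization e S (y(i := z)) = polarization e S y"
        by (intro polarization_cong) auto
      moreover have "S \<subseteq> B" using False that by auto
      ultimately show ?thesis using assms(3) by (simp add: pos_cone_def)
    qed
    then show ?case by (simp add: pos_cone_def)
  qed
qed

text \<open>
  Choose the value \<open>z\<close> of the coordinate \<open>i\<close> so large that the polarization in all variables stays positive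
  along the segment from \<open>x\<close> to \<open>x + 1\<close>, whose far end is in the cone. Then \<open>x\<close>, with
  \<open>z\<close> in place of its coordinate \<open>i\<close>, is in the larger cone.
\<close>

lemma vanishes_on_boundary_facet:
  assumes "finite B" "i \<notin> B" "e 0 = 1" "vanishes_on_boundary e (insert i B)"
  shows "vanishes_on_boundary e B"
  unfolding vanishes_on_boundary_def
proof (intro ballI impI)
  fix x assume x: "x \<in> nonneg_cone e B" "polarization e B x > 0"
  define X where "X = (\<lambda>z \<delta> j. if j = i then z else x j + \<delta>)"
  have XB: "polarization f S (X z \<delta>) = polarization f S (\<lambda>j. x j + \<delta>)" if "S \<subseteq> B" for f S z \<delta>
    by (rule polarization_cong) (use that assms(2) in \<open>auto simp: X_def\<close>)
  have "continuous_on {0..1::real} (\<lambda>\<delta>. polarization (e \<circ> Suc) B (\<lambda>j. x j + \<delta>))"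
    by (intro continuous_on_polarization continuous_intros)
  then obtain \<delta>0 where \<delta>0: "\<And>\<delta>. \<delta> \<in> {0..1} \<Longrightarrow>
      polarization (e \<circ> Suc) B (\<lambda>j. x j + \<delta>0) \<le> polarization (e \<circ> Suc) B (\<lambda>j. x j + \<delta>)"
    using continuous_attains_inf[of "{0..1::real}" "\<lambda>\<delta>. polarization (e \<circ> Suc) B (\<lambda>j. x j + \<delta>)"]
    by (metis compact_Icc atLeastatMost_empty_iff2 zero_less_one_class.zero_le_one)
  define m where "m = polarization (e \<circ> Suc) B (\<lambda>j. x j + \<delta>0)"
  have "(\<lambda>j. x j + 1) \<in> pos_cone e B"
    by (rule nonneg_cone_shift[OF assms(1) _ x(1)]) (use assms(3) in auto)
  moreover have "(\<lambda>j. x j + 1)(i := z) = X z 1" for z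
    by (auto simp: X_def)
  ultimately have "\<forall>\<^sub>F z in at_top. X z 1 \<in> pos_cone e (insert i B)"
    using pos_cone_extend[OF assms(1,2), of "\<lambda>j. x j + 1" e] by simp
  then have "\<forall>\<^sub>F z in at_top. X z 1 \<in> pos_cone e (insert i B) \<and> z > 0
      \<and> z > - m / polarization e B x"
    by (intro eventually_conj eventually_gt_at_top)
  then obtain z where z: "X z 1 \<in> pos_cone e (insert i B)" "z > 0" "z > - m / polarization e B x"
    using eventually_happens'[OF trivial_limit_at_top_linorder] by blast
  have "X z 0 \<in> pos_cone e (insert i B)"
  proof (rule pos_cone_absorbs_path[OF _ assms(4), of "{0..1}" "X z" 1])
    fix j show "continuous_on {0..1} (\<lambda>\<delta>. X z \<delta> j)"
      by (cases "j = i") (auto simp: X_def intro!: continuous_intros)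
  next
    fix \<delta> :: real assume \<delta>: "\<delta> \<in> {0..1}"
    have "0 < z * polarization e B x + m"
      using z x by (simp add: field_simps)
    also have "\<dots> \<le> z * polarization e B (\<lambda>j. x j + \<delta>) + polarization (e \<circ> Suc) B (\<lambda>j. x j + \<delta>)"
      using \<delta> z(2) assms(3) unfolding m_def
      by (intro add_mono mult_left_mono nonneg_cone_mono(1)[OF assms(1) _ x(1)] \<delta>0) auto
    also have "\<dots> = polarization e (insert i B) (X z \<delta>)"
      using assms(1,2) by (simp add: polarization_insert XB) (simp add: X_def)
    finally show "0 < polarization e (insert i B) (X z \<delta>)" .
  qed (use assms z in auto)
  then have "0 < polarization e S x" if "S \<subseteq> B" for S
    using XB[OF that, of e z 0] that by (auto simp: pos_cone_def)
  then show "x \<in> pos_cone e B" by (simp add: pos_cone_def)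
qed

lemma continuous_on_diagonal: "continuous_on T (\<lambda>(t::real) (i::'i). t)"
  by (intro continuous_on_coordinatewise_then_product continuous_intros)

text \<open>
  The diagonal meets the cone in a ray \<open>(T, \<infinity>)\<close>, and the diagonal point at \<open>T\<close> is on the boundary
  of the cone, so the polarization vanishes there.
\<close>

lemma vanishes_on_boundary_largest_root:
  fixes A :: "'i set"
  assumes "finite A" "A \<noteq> {}" "e 0 = 1" "vanishes_on_boundary e A"
  obtains T where "is_largest_root (appell_poly e (card A)) T"
    "\<And>t. t > T \<Longrightarrow> (\<lambda>i. t) \<in> pos_cone e A"
proof -
  define U where "U = {t. (\<lambda>i::'i. t) \<in> pos_cone e A}"
  define T where "T = Inf U"
  have diag: "polarization e S (\<lambda>i. t) = poly (appell_poly e (card S)) t" if "S \<subseteq> A" for S t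
    using assms(1) that finite_subset by (intro polarization_diagonal) auto
  have "\<forall>\<^sub>F t in at_top. 0 < polarization e S (\<lambda>i. t)" if "S \<in> Pow A" for S
  proof -
    have lc: "lead_coeff (appell_poly e (card S)) = 1"
      using assms(3) by (simp add: degree_appell_poly coeff_appell_poly)
    then obtain r where "\<forall>x\<ge>r. 1 \<le> poly (appell_poly e (card S)) x"
      using poly_pinfty_gt_lc[of "appell_poly e (card S)"] by auto
    then show ?thesis
      using that diag[of S]
      by (auto simp: eventually_at_top_linorder intro!: exI[of _ r] less_le_trans[OF zero_less_one])
  qed
  then have "\<forall>\<^sub>F t in at_top. \<forall>S\<in>Pow A. 0 < polarization e S (\<lambda>i. t)"
    using assms(1) by (intro eventually_ball_finite) auto
  then have "\<exists>t. t \<in> U"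
    using eventually_happens'[OF trivial_limit_at_top_linorder]
    unfolding U_def pos_cone_def by blast
  then have "U \<noteq> {}" by auto
  obtain j where j: "j \<in> A" using assms(2) by auto
  \<comment> \<open>The derivative that leaves a single variable is \<open>t + e 1\<close>, which bounds the ray below.\<close>
  have "- e 1 \<le> t" if "t \<in> U" for t
  proof -
    have "0 < polarization e {j} (\<lambda>i. t)" using that j unfolding U_def pos_cone_def by blast
    then show ?thesis using assms(3) by simp
  qed
  then have bdd: "bdd_below U" by (rule bdd_belowI)
  have above: "t \<in> U" if gt: "t > T" for t
  proof -
    obtain s where "s \<in> U" "s < t"
      using gt cInf_lessD[OF \<open>U \<noteq> {}\<close>] unfolding T_def by blast
    then show ?thesis
      using pos_cone_upward[OF assms(1), of e "\<lambda>i. s" "\<lambda>i. t"] assms(3) by (simp add: U_def)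
  qed
  have nn: "(\<lambda>i. T) \<in> nonneg_cone e A"
  proof -
    have "0 \<le> polarization e S (\<lambda>i. T)" if "S \<subseteq> A" for S
    proof -
      have "((\<lambda>t. poly (appell_poly e (card S)) t) \<longlongrightarrow> poly (appell_poly e (card S)) T) (at_right T)"
        by (intro tendsto_intros)
      moreover have "\<forall>\<^sub>F t in at_right T. 0 \<le> poly (appell_poly e (card S)) t"
        using eventually_at_right_less[of T]
      proof eventually_elim
        case (elim t)
        then have "0 < polarization e S (\<lambda>i. t)"
          using above that by (auto simp: U_def pos_cone_def)
        then show ?case using diag[OF that] by simp
      qed
      ultimately show ?thesis
        unfolding diag[OF that] by (rule tendsto_lowerbound) simp
    qed
    then show ?thesis by (simp add: nonneg_cone_def)
  qed
  have "T \<notin> U"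
  proof
    assume "T \<in> U"
    have "U = (\<lambda>t i. t) -` pos_cone e A" by (auto simp: U_def)
    then have "open U"
      using open_vimage[OF open_pos_cone[OF assms(1), of e] continuous_on_diagonal] by simp
    then obtain d where "d > 0" "ball T d \<subseteq> U"
      using \<open>T \<in> U\<close> open_contains_ball by metis
    then have "T - d / 2 \<in> U" by (auto simp: dist_real_def subset_iff)
    then show False using cInf_lower[OF _ bdd, of "T - d / 2"] \<open>d > 0\<close> by (simp add: T_def)
  qed
  then have "\<not> 0 < polarization e A (\<lambda>i. T)"
    using nn assms(4) by (auto simp: vanishes_on_boundary_def U_def)
  moreover have "0 \<le> polarization e A (\<lambda>i. T)"
    using nn by (auto simp: nonneg_cone_def)
  ultimately have "poly (appell_poly e (card A)) T = 0" by (simp add: diag)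
  moreover have "0 < poly (appell_poly e (card A)) t" if "t > T" for t
    using above[OF that] diag[of A t] by (auto simp: U_def pos_cone_def)
  ultimately have "is_largest_root (appell_poly e (card A)) T"
    unfolding is_largest_root_def by (metis less_irrefl not_le)
  then show ?thesis
    using that above by (auto simp: U_def)
qed

lemma vanishes_on_boundary_lessThan:
  assumes "vanishes_on_boundary e {..<n::nat}" "e 0 = 1" "m \<le> n"
  shows "vanishes_on_boundary e {..<m}"
  using assms(3)
proof (induction rule: inc_induct)
  case base
  then show ?case by (rule assms(1))
next
  case (step k)
  then show ?case
    using vanishes_on_boundary_facet[of "{..<k}" k e] assms(2) by (simp add: lessThan_Suc)
qed

lemma vanishes_on_boundary_noetherian_chain:
  assumes "vanishes_on_boundary e {..<n::nat}" "e 0 = 1"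
  shows "noetherian_chain e n"
  unfolding noetherian_chain_def
proof (intro allI impI)
  fix m assume m: "1 \<le> m \<and> m < n"
  then have V: "vanishes_on_boundary e {..<m}" "vanishes_on_boundary e {..<Suc m}"
    using vanishes_on_boundary_lessThan[OF assms] by auto
  have ne: "{..<m} \<noteq> {}" "{..<Suc m} \<noteq> {}" using m by (auto simp: lessThan_empty_iff)
  obtain y where y: "is_largest_root (appell_poly e (card {..<m})) y"
    using vanishes_on_boundary_largest_root[OF finite_lessThan ne(1) assms(2) V(1)] by metis
  obtain x where x: "is_largest_root (appell_poly e (card {..<Suc m})) x"
    "\<And>t. t > x \<Longrightarrow> (\<lambda>i. t) \<in> pos_cone e {..<Suc m}"
    using vanishes_on_boundary_largest_root[OF finite_lessThan ne(2) assms(2) V(2)] by metis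
  have "y \<le> x"
  proof (rule ccontr)
    assume "\<not> y \<le> x"
    then have "0 < polarization e {..<m} (\<lambda>i. y)"
      using x(2)[of y] by (auto simp: pos_cone_def)
    then show False
      using y by (simp add: polarization_diagonal is_largest_root_def)
  qed
  then show "\<exists>x y. poly (appell_poly e (Suc m)) x = 0 \<and> is_largest_root (appell_poly e m) y \<and> y \<le> x"
    using x(1) y by (auto simp: is_largest_root_def)
qed

lemma noetherian_chain_iff:
  assumes "e 0 = 1"
  shows "noetherian_chain e n \<longleftrightarrow> vanishes_on_boundary e {..<n}"
  using vanishes_on_boundary_noetherian_chain[of e n] assms
    noetherian_chain_vanishes_on_boundary[of e n "{..<n}"] by auto

section \<open>Stable components\<close>

text \<open>
  The only possible stable component of the set where \<open>polarization e {..<n}\<close> is positive.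
\<close>

definition stable_component :: "nat \<Rightarrow> (nat \<Rightarrow> real) \<Rightarrow> (nat \<Rightarrow> real) set" where
  "stable_component n e = topspace (Euclidean_space n) \<inter> pos_cone e {..<n}"

lemma Euclidean_space_eq: "Euclidean_space n = top_of_set (topspace (Euclidean_space n))"
  by (simp add: Euclidean_space_def euclidean_product_topology)

lemma positive_components_eq:
  "positive_components n f = components (topspace (Euclidean_space n) \<inter> {x. f x > 0})"
proof -
  define V where "V = topspace (Euclidean_space n) \<inter> {x. f x > 0}"
  have sub: "subtopology (Euclidean_space n) {x. f x > 0} = top_of_set V"
    unfolding V_def by (subst Euclidean_space_eq) (simp add: subtopology_subtopology)
  have "connected_component_of (top_of_set V) = connected_component V"
    by (intro ext) (auto simp: connected_component_of_def connected_component_def connectedin_subtopology)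
  then show ?thesis
    by (simp add: positive_components_def sub connected_components_of_def components_def
        flip: V_def)
qed

lemma connected_stable_component:
  assumes "e 0 \<ge> 0"
  shows "connected (stable_component n e)"
  unfolding connected_iff_connected_component
proof (intro ballI)
  let ?G = "stable_component n e"
  \<comment> \<open>Two points are joined through their coordinatewise maximum, along segments that go upwards.\<close>
  have join: "connected_component ?G x z"
    if "x \<in> ?G" "z \<in> ?G" "\<And>i. x i \<le> z i" for x z
  proof -
    define \<gamma> where "\<gamma> = (\<lambda>t i. x i + t * (z i - x i))"
    have in_G: "\<gamma> t \<in> ?G" if t: "t \<in> {0..1}" for t
    proof -
      have "x i \<le> \<gamma> t i" for i
        using t \<open>x i \<le> z i\<close> by (simp add: \<gamma>_def)
      moreover have "x \<in> pos_cone e {..<n}"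
        using \<open>x \<in> ?G\<close> by (simp add: stable_component_def)
      ultimately have "\<gamma> t \<in> pos_cone e {..<n}"
        using pos_cone_upward[of "{..<n}" e x "\<gamma> t"] assms by simp
      then show ?thesis
        using \<open>x \<in> ?G\<close> \<open>z \<in> ?G\<close>
        by (simp add: stable_component_def \<gamma>_def topspace_Euclidean_space)
    qed
    have "connected (\<gamma> ` {0..1})"
      unfolding \<gamma>_def
      by (intro connected_continuous_image continuous_on_coordinatewise_then_product
          continuous_intros) simp
    moreover have "\<gamma> ` {0..1} \<subseteq> ?G" using in_G by blast
    moreover have "x \<in> \<gamma> ` {0..1}" by (rule image_eqI[of _ _ 0]) (auto simp: \<gamma>_def)
    moreover have "z \<in> \<gamma> ` {0..1}" by (rule image_eqI[of _ _ 1]) (auto simp: \<gamma>_def)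
    ultimately show ?thesis
      unfolding connected_component_def by blast
  qed
  fix x y assume xy: "x \<in> ?G" "y \<in> ?G"
  define z where "z = (\<lambda>i. max (x i) (y i))"
  have "z \<in> ?G"
    using xy assms pos_cone_upward[of "{..<n}" e x z]
    by (auto simp: stable_component_def z_def topspace_Euclidean_space)
  then have "connected_component ?G x z" "connected_component ?G y z"
    using xy by (auto intro!: join simp: z_def)
  then show "connected_component ?G x y"
    by (meson connected_component_sym connected_component_trans)
qed

lemma stable_component_ne:
  assumes "n \<ge> 1" "e 0 = 1" "vanishes_on_boundary e {..<n}"
  shows "stable_component n e \<noteq> {}"
proof -
  have "{..<n} \<noteq> {}" using assms(1) by (auto simp: lessThan_empty_iff)
  then obtain T where "\<And>t. t > T \<Longrightarrow> (\<lambda>i. t) \<in> pos_cone e {..<n}"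
    using vanishes_on_boundary_largest_root[OF finite_lessThan _ assms(2,3)] by metis
  then have "(\<lambda>i. T + 1) \<in> pos_cone e {..<n}" by simp
  then have "diag_point n (T + 1) \<in> stable_component n e"
    using assms(2) pos_cone_upward[of "{..<n}" e "\<lambda>i. T + 1" "diag_point n (T + 1)"]
    by (auto simp: stable_component_def diag_point_def topspace_Euclidean_space)
  then show ?thesis by auto
qed

lemma stable_component_in_components:
  assumes "n \<ge> 1" "e 0 = 1" "vanishes_on_boundary e {..<n}"
  shows "stable_component n e \<in> components (topspace (Euclidean_space n) \<inter> {x. polarization e {..<n} x > 0})"
  unfolding in_components_maximal
proof (intro conjI allI impI)
  show "stable_component n e \<noteq> {}" by (rule stable_component_ne[OF assms])
  show "stable_component n e \<subseteq> topspace (Euclidean_space n) \<inter> {x. polarization e {..<n} x > 0}"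
    by (auto simp: stable_component_def pos_cone_def)
  show "connected (stable_component n e)"
    using assms by (intro connected_stable_component) simp
  fix D assume D: "D \<noteq> {} \<and> stable_component n e \<subseteq> D \<and>
     D \<subseteq> topspace (Euclidean_space n) \<inter> {x. polarization e {..<n} x > 0} \<and> connected D"
  obtain x where "x \<in> stable_component n e" using stable_component_ne[OF assms] by auto
  then have "D \<subseteq> pos_cone e {..<n}"
    using D by (intro pos_cone_absorbs_connected[OF finite_lessThan assms(3), of D x])
      (auto simp: stable_component_def)
  then show "D = stable_component n e"
    using D by (auto simp: stable_component_def)
qed

lemma component_absorbs_path:
  fixes \<gamma> :: "real \<Rightarrow> nat \<Rightarrow> real"
  assumes "G \<in> components (topspace (Euclidean_space n) \<inter> {x. f x > 0})" "connected J"
    and "\<And>i. continuous_on J (\<lambda>t. \<gamma> t i)" "\<And>t i. t \<in> J \<Longrightarrow> i \<ge> n \<Longrightarrow> \<gamma> t i = 0"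
    and "\<And>t. t \<in> J \<Longrightarrow> f (\<gamma> t) > 0" "s \<in> J" "\<gamma> s \<in> G" "t \<in> J"
  shows "\<gamma> t \<in> G"
proof -
  have "\<gamma> ` J \<subseteq> G"
    using assms
    by (intro components_maximal[OF assms(1)] connected_continuous_image
        continuous_on_coordinatewise_then_product)
       (auto simp: topspace_Euclidean_space)
  then show ?thesis using assms by auto
qed

text \<open>
  A point where all derivatives are nonnegative and the polarization is positive is the end of a
  diagonal segment whose other points are in the cone. A component that contains the cone contains
  this segment.
\<close>

lemma stable_component_vanishes_on_boundary:
  assumes "e 0 = 1"
    and G: "stable_component n e \<in> components (topspace (Euclidean_space n) \<inter> {x. polarization e {..<n} x > 0})"
  shows "vanishes_on_boundary e {..<n}"
  unfolding vanishes_on_boundary_def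
proof (intro ballI impI)
  fix x assume x: "x \<in> nonneg_cone e {..<n}" "polarization e {..<n} x > 0"
  define X where "X = (\<lambda>\<delta> i. if i < n then x i + \<delta> else 0)"
  have X0: "polarization e S (X 0) = polarization e S x" if "S \<subseteq> {..<n}" for S
    by (rule polarization_cong) (use that in \<open>auto simp: X_def\<close>)
  have cone: "X \<delta> \<in> pos_cone e {..<n}" if "\<delta> > 0" for \<delta>
    using that assms(1) by (intro nonneg_cone_shift[OF _ _ x(1)]) (auto simp: X_def)
  have "X 0 \<in> stable_component n e"
  proof (rule component_absorbs_path[OF G, of "{0..1}" X 1])
    fix \<delta> :: real assume "\<delta> \<in> {0..1}"
    then show "0 < polarization e {..<n} (X \<delta>)"
      using X0[of "{..<n}"] x(2) cone[of \<delta>] by (cases "\<delta> = 0") (auto simp: pos_cone_def)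
  next
    fix i show "continuous_on {0..1} (\<lambda>t. X t i)"
      by (cases "i < n") (auto simp: X_def intro!: continuous_intros)
  next
    show "X 1 \<in> stable_component n e"
      using cone[of 1] by (auto simp: stable_component_def topspace_Euclidean_space X_def)
  qed (auto simp: X_def)
  then show "x \<in> pos_cone e {..<n}"
    using X0 by (auto simp: stable_component_def pos_cone_def)
qed

lemma upsilon_stable_stable_component:
  assumes "e 0 = 1"
  shows "upsilon_stable n (stable_component n e)"
proof -
  define q where "q = (\<lambda>i. if i < n then - e 1 else 0)"
  have "x \<in> (\<lambda>x i. q i + x i) ` positive_orthant n" if x: "x \<in> stable_component n e" for x
  proof (rule image_eqI)
    have "0 < x i + e 1" if "i < n" for i
    proof -
      have "0 < polarization e {i} x"
        using x that unfolding stable_component_def pos_cone_def by blast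
      then show ?thesis using assms by simp
    qed
    then show "(\<lambda>i. x i - q i) \<in> positive_orthant n"
      using x by (auto simp: positive_orthant_def stable_component_def topspace_Euclidean_space q_def
          algebra_simps)
  qed auto
  moreover have "q \<in> topspace (Euclidean_space n)"
    by (simp add: q_def topspace_Euclidean_space)
  ultimately show ?thesis unfolding upsilon_stable_def by blast
qed

text \<open>
  If the slope in the coordinate \<open>i\<close> were not positive, lowering that coordinate would keep the
  polarization positive and reach the wall \<open>x i = q i\<close> of the translated orthant.
\<close>

lemma upsilon_stable_component_facet_pos:
  assumes G: "G \<in> components (topspace (Euclidean_space n) \<inter> {x. polarization e {..<n} x > 0})"
    and "upsilon_stable n G" "x \<in> G" "i < n"
  shows "polarization e ({..<n} - {i}) x > 0"
proof (rule ccontr)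
  assume neg: "\<not> ?thesis"
  obtain q where Q: "G \<subseteq> (\<lambda>x i. q i + x i) ` positive_orthant n"
    using assms(2) unfolding upsilon_stable_def by blast
  have q: "q i < z i" if z: "z \<in> G" for z
  proof -
    obtain p where "p \<in> positive_orthant n" "z = (\<lambda>i. q i + p i)" using Q z by blast
    then show ?thesis using assms(4) by (simp add: positive_orthant_def)
  qed
  have x: "polarization e {..<n} x > 0" "\<And>i. i \<ge> n \<Longrightarrow> x i = 0"
    using assms(3) in_components_subset[OF G] by (auto simp: topspace_Euclidean_space)
  have "x(i := q i) \<in> G"
  proof (rule component_absorbs_path[OF G, of "{q i..x i}" "\<lambda>t. x(i := t)" "x i"])
    fix t assume "t \<in> {q i..x i}"
    then have "0 \<le> (t - x i) * polarization e ({..<n} - {i}) x"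
      using neg by (intro mult_nonpos_nonpos) auto
    then show "0 < polarization e {..<n} (x(i := t))"
      using x assms(4) by (simp add: polarization_affine)
  next
    fix j show "continuous_on {q i..x i} (\<lambda>t. (x(i := t)) j)"
      by (cases "j = i") (auto intro!: continuous_intros)
  qed (use assms(3,4) x(2) q[OF assms(3)] in auto)
  then show False using q[of "x(i := q i)"] by simp
qed

text \<open>
  Positive slopes make the component upward closed, and a derivative that is nonnegative on an
  upward closed set has nonnegative derivatives itself. So all derivatives are nonnegative on the
  component, and moving a point slightly down the diagonal inside the component shows that they
  are even positive. The component is thus contained in the connected set
  \<open>stable_component n e\<close>, and maximality gives equality.
\<close>

lemma upsilon_stable_component_eq:
  assumes "e 0 = 1"
    and G: "G \<in> components (topspace (Euclidean_space n) \<inter> {x. polarization e {..<n} x > 0})"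
    and "upsilon_stable n G"
  shows "G = stable_component n e"
proof -
  have x: "polarization e {..<n} x > 0" "\<And>i. i \<ge> n \<Longrightarrow> x i = 0" if "x \<in> G" for x
    using that in_components_subset[OF G] by (auto simp: topspace_Euclidean_space)
  have up: "x(i := t) \<in> G" if "x \<in> G" "i < n" "x i \<le> t" for x i t
  proof (rule component_absorbs_path[OF G, of "{x i..t}" "\<lambda>t. x(i := t)" "x i"])
    fix s assume "s \<in> {x i..t}"
    then have "0 \<le> (s - x i) * polarization e ({..<n} - {i}) x"
      using upsilon_stable_component_facet_pos[OF G assms(3) that(1,2)]
      by (intro mult_nonneg_nonneg) auto
    then show "0 < polarization e {..<n} (x(i := s))"
      using x(1)[OF that(1)] that(2) by (simp add: polarization_affine)
  next
    fix j show "continuous_on {x i..t} (\<lambda>s. (x(i := s)) j)"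
      by (cases "j = i") (auto intro!: continuous_intros)
  qed (use that x(2)[OF that(1)] in auto)
  have nonneg: "polarization e ({..<n} - R) x \<ge> 0" if "x \<in> G" "finite R" "R \<subseteq> {..<n}" for R x
    using that(2,3,1)
  proof (induction R arbitrary: x rule: finite_induct)
    case empty
    show ?case unfolding Diff_empty by (rule less_imp_le[OF x(1)[OF empty(2)]])
  next
    case (insert i R)
    let ?g = "polarization e ({..<n} - R - {i}) x"
    show ?case
    proof (rule ccontr)
      assume "\<not> ?case"
      moreover have "{..<n} - insert i R = {..<n} - R - {i}" by auto
      ultimately have neg: "?g < 0" by simp
      \<comment> \<open>A step long enough to bring the function with negative slope down to the value -1.\<close>
      define s where "s = (polarization e ({..<n} - R) x + 1) / - ?g"
      have "0 \<le> polarization e ({..<n} - R) x" using insert by auto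
      then have "s \<ge> 0" using neg by (simp add: s_def divide_nonneg_neg divide_nonneg_pos)
      then have "x(i := x i + s) \<in> G" using insert by (intro up) auto
      then have "0 \<le> polarization e ({..<n} - R) (x(i := x i + s))" using insert by auto
      also have "\<dots> = polarization e ({..<n} - R) x + s * ?g"
        using insert.hyps insert.prems by (subst polarization_affine) auto
      also have "s * ?g = - (polarization e ({..<n} - R) x + 1)"
        using neg by (simp add: s_def)
      finally show False by simp
    qed
  qed
  have "x \<in> stable_component n e" if "x \<in> G" for x
  proof -
    define X where "X = (\<lambda>\<delta> i. if i < n then x i - \<delta> else 0)"
    have X0: "X 0 = x" using x(2)[OF that] by (auto simp: X_def)
    have "continuous_on UNIV (\<lambda>\<delta>. polarization e {..<n} (X \<delta>))"
      by (intro continuous_on_polarization) (auto simp: X_def intro!: continuous_intros)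
    then have "((\<lambda>\<delta>. polarization e {..<n} (X \<delta>)) \<longlongrightarrow> polarization e {..<n} (X 0)) (at 0)"
      by (simp add: continuous_on_eq_continuous_at isCont_def)
    then have "\<forall>\<^sub>F \<delta> in at 0. 0 < polarization e {..<n} (X \<delta>)"
      using x(1)[OF that] X0 by (intro order_tendstoD(1)) auto
    then obtain d where d: "d > 0" "\<And>\<delta>. \<delta> \<noteq> 0 \<Longrightarrow> dist \<delta> 0 < d \<Longrightarrow> 0 < polarization e {..<n} (X \<delta>)"
      unfolding eventually_at by auto
    have "X (d / 2) \<in> G"
    proof (rule component_absorbs_path[OF G, of "{0..d / 2}" X 0])
      fix \<delta> assume "\<delta> \<in> {0..d / 2}"
      then show "0 < polarization e {..<n} (X \<delta>)"
        using d(1) d(2)[of \<delta>] X0 x(1)[OF that] by (cases "\<delta> = 0") auto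
    next
      fix i show "continuous_on {0..d / 2} (\<lambda>t. X t i)"
        by (cases "i < n") (auto simp: X_def intro!: continuous_intros)
    qed (use d that X0 in \<open>auto simp: X_def\<close>)
    then have "polarization e S (X (d / 2)) \<ge> 0" if "S \<subseteq> {..<n}" for S
      using nonneg[of "X (d / 2)" "{..<n} - S"] that by (simp add: double_diff)
    then have "X (d / 2) \<in> nonneg_cone e {..<n}" by (simp add: nonneg_cone_def)
    then have "x \<in> pos_cone e {..<n}"
      by (rule nonneg_cone_shift[rotated 2]) (use d(1) assms(1) in \<open>auto simp: X_def\<close>)
    then show ?thesis
      using x(2)[OF that] by (simp add: stable_component_def topspace_Euclidean_space)
  qed
  then have sub: "G \<subseteq> stable_component n e" by auto
  have "G \<noteq> {}" using in_components_nonempty[OF G] .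
  then have "G \<inter> stable_component n e \<noteq> {}" using sub by blast
  then have "stable_component n e \<subseteq> G"
    using assms(1) by (intro components_maximal[OF G] connected_stable_component)
      (auto simp: stable_component_def pos_cone_def)
  with sub show ?thesis by auto
qed

section \<open>The frontier and strict stability\<close>

lemma frontier_stable_component:
  assumes "e 0 = 1" "vanishes_on_boundary e {..<n}"
    and x: "x \<in> Euclidean_space n frontier_of stable_component n e"
  shows "x \<in> topspace (Euclidean_space n)" "x \<in> nonneg_cone e {..<n}" "polarization e {..<n} x = 0"
proof -
  let ?W = "topspace (Euclidean_space n)" and ?G = "stable_component n e"
  have "closedin (Euclidean_space n) (?W \<inter> nonneg_cone e {..<n})"
    using closedin_Euclidean_imp_closed[OF closedin_topspace] closed_nonneg_cone
    unfolding closedin_Euclidean_space_iff by blast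
  moreover have "?G \<subseteq> ?W \<inter> nonneg_cone e {..<n}"
    using pos_cone_subset_nonneg_cone[of e "{..<n}"] by (auto simp: stable_component_def)
  ultimately have "Euclidean_space n closure_of ?G \<subseteq> ?W \<inter> nonneg_cone e {..<n}"
    by (rule closure_of_minimal[rotated])
  then show "x \<in> ?W" and nn: "x \<in> nonneg_cone e {..<n}"
    using x by (auto simp: frontier_of_def)
  have "openin (Euclidean_space n) ?G"
    unfolding stable_component_def
    by (subst Euclidean_space_eq) (simp add: openin_open_Int open_pos_cone)
  then have "x \<notin> ?G"
    using x by (simp add: frontier_of_def interior_of_openin)
  then have "\<not> 0 < polarization e {..<n} x"
    using nn \<open>x \<in> ?W\<close> assms(2) by (auto simp: stable_component_def vanishes_on_boundary_def)
  moreover have "0 \<le> polarization e {..<n} x"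
    using nn by (auto simp: nonneg_cone_def)
  ultimately show "polarization e {..<n} x = 0" by simp
qed

lemma diag_point_in_frontier:
  assumes "e 0 = 1" "polarization e {..<n} (\<lambda>i. T) = 0"
    and "\<And>t. t > T \<Longrightarrow> (\<lambda>i. t) \<in> pos_cone e {..<n}"
  shows "diag_point n T \<in> Euclidean_space n frontier_of stable_component n e"
proof -
  let ?W = "topspace (Euclidean_space n)" and ?G = "stable_component n e"
  have W: "diag_point n t \<in> ?W" for t
    by (simp add: diag_point_def topspace_Euclidean_space)
  have pol: "polarization e S (diag_point n t) = polarization e S (\<lambda>i. t)" if "S \<subseteq> {..<n}" for S t
    by (rule polarization_cong) (use that in \<open>auto simp: diag_point_def\<close>)
  have "continuous_on UNIV (diag_point n)"
    unfolding diag_point_def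
  proof (rule continuous_on_coordinatewise_then_product)
    show "continuous_on UNIV (\<lambda>t::real. if i < n then t else 0)" for i
      by (cases "i < n") (auto intro!: continuous_intros)
  qed
  then have "(diag_point n \<longlongrightarrow> diag_point n T) (at_right T)"
    by (simp add: continuous_on_eq_continuous_at isCont_def filterlim_at_split)
  moreover have "diag_point n t \<in> ?G" if "t > T" for t
    using assms(3)[OF that] pol W by (auto simp: stable_component_def pos_cone_def)
  then have "\<forall>\<^sub>F t in at_right T. diag_point n t \<in> closure ?G"
    using closure_subset[of ?G]
    by (auto intro: eventually_mono[OF eventually_at_right_less])
  ultimately have "diag_point n T \<in> closure ?G"
    by (intro Lim_in_closed_set[OF closed_closure]) auto
  moreover have "Euclidean_space n closure_of ?G = ?W \<inter> closure ?G"
  proof -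
    have "?W \<inter> ?G = ?G" by (auto simp: stable_component_def)
    then have "top_of_set ?W closure_of ?G = ?W \<inter> closure ?G"
      using closure_of_subtopology[of euclidean ?W ?G] by simp
    then show ?thesis by (simp flip: Euclidean_space_eq)
  qed
  ultimately have "diag_point n T \<in> Euclidean_space n closure_of ?G"
    using W[of T] by (metis IntI)
  moreover have "diag_point n T \<notin> Euclidean_space n interior_of ?G"
  proof
    assume "diag_point n T \<in> Euclidean_space n interior_of ?G"
    then have "diag_point n T \<in> ?G" by (rule subsetD[OF interior_of_subset])
    then have "0 < polarization e {..<n} (diag_point n T)"
      by (auto simp: stable_component_def pos_cone_def)
    then show False using assms(2) pol[of "{..<n}" T] by simp
  qed
  ultimately show ?thesis by (simp add: frontier_of_def)
qed

text \<open>
  A large last coordinate can always be added to a point of the cone in \<open>n - 1\<close> variables.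
\<close>

lemma drop_last_stable_component:
  assumes "n \<ge> 1" "x \<in> pos_cone e {..<n - 1}"
  shows "drop_last n x \<in> drop_last n ` stable_component n e"
proof -
  define y where "y = (\<lambda>i. if i < n then x i else 0)"
  have "polarization e S y = polarization e S x" if "S \<subseteq> {..<n - 1}" for S
    by (rule polarization_cong) (use that in \<open>auto simp: y_def\<close>)
  then have "y \<in> pos_cone e {..<n - 1}"
    using assms(2) by (auto simp: pos_cone_def)
  then have "\<forall>\<^sub>F z in at_top. y(n - 1 := z) \<in> pos_cone e (insert (n - 1) {..<n - 1})"
    by (intro pos_cone_extend) auto
  then obtain z where "y(n - 1 := z) \<in> pos_cone e (insert (n - 1) {..<n - 1})"
    using eventually_happens'[OF trivial_limit_at_top_linorder] by blast
  moreover have "insert (n - 1) {..<n - 1} = {..<n}" using assms(1) by auto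
  ultimately have "y(n - 1 := z) \<in> stable_component n e"
    using assms(1) by (auto simp: stable_component_def topspace_Euclidean_space y_def)
  moreover have "drop_last n x = drop_last n (y(n - 1 := z))"
    by (rule ext) (auto simp: drop_last_def y_def)
  ultimately show ?thesis by (metis image_eqI)
qed

text \<open>
  Membership in \<open>\<Upsilon>\<^sub>1\<close> amounts to positivity of all derivatives of positive order. On the frontier
  the polarization is zero, so by the boundary inequality no first-order derivative can vanish
  there if \<open>appell_poly e n\<close> is negative at the largest root of its derivative. Conversely, the
  diagonal frontier point is at the largest root of \<open>appell_poly e n\<close>, where the derivative must
  be positive.
\<close>

lemma frontier_subset_upsilon_1_iff:
  assumes n: "n \<ge> 2" and e: "e 0 = 1" and V: "vanishes_on_boundary e {..<n}"
  shows "Euclidean_space n frontier_of stable_component n e \<subseteq> upsilon_1 n (stable_component n e)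
    \<longleftrightarrow> (\<exists>x y. is_largest_root (appell_poly e n) x \<and> is_largest_root (appell_poly e (n - 1)) y \<and> x > y)"
    (is "?F \<subseteq> ?Y \<longleftrightarrow> _")
proof
  assume sub: "?F \<subseteq> ?Y"
  have V': "vanishes_on_boundary e {..<n - 1}"
    by (rule vanishes_on_boundary_lessThan[OF V e]) simp
  have ne: "{..<n} \<noteq> {}" "{..<n - 1} \<noteq> {}" using n by (auto simp: lessThan_empty_iff)
  obtain x where x: "is_largest_root (appell_poly e (card {..<n})) x"
    "\<And>t. t > x \<Longrightarrow> (\<lambda>i. t) \<in> pos_cone e {..<n}"
    using vanishes_on_boundary_largest_root[OF finite_lessThan ne(1) e V] by metis
  obtain y where y: "is_largest_root (appell_poly e (card {..<n - 1})) y"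
    using vanishes_on_boundary_largest_root[OF finite_lessThan ne(2) e V'] by metis
  have "diag_point n x \<in> ?F"
    using x by (intro diag_point_in_frontier[of e, OF e])
      (auto simp: polarization_diagonal is_largest_root_def)
  then have "diag_point n x \<in> ?Y" using sub by blast
  \<comment> \<open>The diagonal is symmetric, so the identity permutation gives all the information.\<close>
  then have "drop_last n (\<lambda>i. diag_point n x (id i)) \<in> drop_last n ` stable_component n e"
    unfolding upsilon_1_def using permutes_id by blast
  then obtain g where g: "g \<in> stable_component n e" "drop_last n (diag_point n x) = drop_last n g"
    by auto
  have "polarization e {..<n - 1} (\<lambda>i. x) = polarization e {..<n - 1} g"
  proof (rule polarization_cong)
    fix i assume "i \<in> {..<n - 1}"
    then show "x = g i"
      using fun_cong[OF g(2), of i] by (simp add: drop_last_def diag_point_def split: if_splits)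
  qed
  also have "0 < \<dots>"
    using g(1) by (auto simp: stable_component_def pos_cone_def)
  finally have pos: "0 < poly (appell_poly e (n - 1)) x"
    by (simp add: polarization_diagonal)
  have "y < x"
  proof (rule ccontr)
    assume "\<not> y < x"
    then consider "y = x" | "x < y" by linarith
    then show False
    proof cases
      case 1
      then show False using y(1) pos by (simp add: is_largest_root_def)
    next
      case 2
      then have "0 < polarization e {..<n - 1} (\<lambda>i. y)"
        using x(2)[OF 2] by (auto simp: pos_cone_def)
      then show False using y(1) by (simp add: polarization_diagonal is_largest_root_def)
    qed
  qed
  then show "\<exists>x y. is_largest_root (appell_poly e n) x \<and> is_largest_root (appell_poly e (n - 1)) y \<and> x > y"
    using x(1) y(1) by auto
next
  assume "\<exists>x y. is_largest_root (appell_poly e n) x \<and> is_largest_root (appell_poly e (n - 1)) y \<and> x > y"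
  then obtain a b where ab: "is_largest_root (appell_poly e n) a"
    "is_largest_root (appell_poly e (n - 1)) b" "b < a" by blast
  have Suc: "Suc (n - 1) = n" using n by simp
  have neg: "poly (appell_poly e n) b < 0"
    using appell_poly_strict_mono[of e, OF _ ab(2) order_refl ab(3)] ab(1) e Suc
    by (simp add: is_largest_root_def)
  have facet: "vanishes_on_boundary e B" if "finite B" "card B \<le> n" for B :: "nat set"
    using V e that noetherian_chain_iff noetherian_chain_vanishes_on_boundary by metis
  show "?F \<subseteq> ?Y"
  proof
    fix x assume "x \<in> ?F"
    note x = frontier_stable_component[of e, OF e V this]
    have pos: "0 < polarization e S x" if sub: "S \<subset> {..<n}" for S
    proof -
      obtain i where i: "i < n" "S \<subseteq> {..<n} - {i}" using sub by blast
      let ?B = "{..<n} - {i}"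
      have B: "finite ?B" "i \<notin> ?B" "card ?B = n - 1" "insert i ?B = {..<n}" using i by auto
      have nn: "x \<in> nonneg_cone e ?B" using x(2) by (auto simp: nonneg_cone_def)
      have VB: "vanishes_on_boundary e ?B" using facet B by simp
      have "polarization e ?B x \<noteq> 0"
      proof
        assume "polarization e ?B x = 0"
        then have "polarization e (insert i ?B) x \<le> poly (appell_poly e (Suc (card ?B))) b"
          using polarization_le_appell_poly[OF B(1,2) VB e _ nn] ab(2) B(3) by simp
        then show False using neg x(3) B(3) Suc unfolding B(4) by simp
      qed
      moreover have "0 \<le> polarization e ?B x" using nn by (auto simp: nonneg_cone_def)
      ultimately have "x \<in> pos_cone e ?B"
        using VB nn by (auto simp: vanishes_on_boundary_def)
      then show ?thesis using i(2) by (auto simp: pos_cone_def)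
    qed
    have "drop_last n (\<lambda>i. x (s i)) \<in> drop_last n ` stable_component n e" if s: "s permutes {..<n}" for s
    proof (rule drop_last_stable_component)
      \<comment> \<open>Permuting coordinates replaces \<open>S\<close> by its image, which is still a proper subset because
        the last index is missing from \<open>S\<close>.\<close>
      have "0 < polarization e S (x \<circ> s)" if "S \<subseteq> {..<n - 1}" for S
      proof -
        have inj: "inj_on s S" using permutes_inj[OF s] by (auto simp: inj_on_def)
        have fin: "finite S" using that finite_subset by auto
        have "card (s ` S) < card {..<n}"
          using card_mono[OF _ that] n card_image[OF inj] by simp
        moreover have "s ` S \<subseteq> {..<n}"
          using that permutes_in_image[OF s] by fastforce
        ultimately have "s ` S \<subset> {..<n}" by auto
        then show ?thesis
          using pos polarization_reindex[OF inj fin, of e x] by simp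
      qed
      then show "(\<lambda>i. x (s i)) \<in> pos_cone e {..<n - 1}"
        by (simp add: pos_cone_def o_def)
    qed (use n in simp)
    then show "x \<in> ?Y" using x(1) by (auto simp: upsilon_1_def)
  qed
qed

section \<open>Symmetric polynomials as polarizations\<close>

text \<open>
  The signed coefficients of \<open>f_sigma n c\<close>, indexed by codegree instead of degree.
\<close>

definition appell_coeffs :: "nat \<Rightarrow> (nat \<Rightarrow> real) \<Rightarrow> nat \<Rightarrow> real" where
  "appell_coeffs n c j = (if j = 0 then 1 else - c (n - j))"

lemma appell_coeffs_0 [simp]: "appell_coeffs n c 0 = 1"
  by (simp add: appell_coeffs_def)

lemma diag_restriction_eq: "diag_restriction n c = appell_poly (appell_coeffs n c) n"
proof (rule poly_eqI)
  fix k
  have "(\<Sum>j<n. if j = k then c j * real (n choose j) else 0)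
      = (if k < n then c k * real (n choose k) else 0)"
    by (simp add: sum.delta)
  then show "coeff (diag_restriction n c) k = coeff (appell_poly (appell_coeffs n c) n) k"
    by (auto simp: diag_restriction_def coeff_appell_poly coeff_sum appell_coeffs_def)
qed

lemma f_sigma_eq: "f_sigma n c = polarization (appell_coeffs n c) {..<n}"
proof
  fix x :: "nat \<Rightarrow> real"
  let ?e = "appell_coeffs n c"
  have "polarization ?e {..<n} x = (\<Sum>S\<in>Pow {..<n}. ?e (n - card S) * (\<Prod>i\<in>S. x i))"
    unfolding polarization_def
    by (intro sum.cong) (auto simp: card_Diff_subset finite_subset)
  also have "\<dots> = (\<Sum>k\<le>n. \<Sum>S | S \<in> Pow {..<n} \<and> card S = k. ?e (n - card S) * (\<Prod>i\<in>S. x i))"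
    using card_mono[of "{..<n}"] by (intro sum.group[symmetric]) auto
  also have "\<dots> = (\<Sum>k\<le>n. ?e (n - k) * esym n k x)"
    by (intro sum.cong) (auto simp: esym_def sum_distrib_left)
  also have "\<dots> = esym n n x + (\<Sum>k<n. ?e (n - k) * esym n k x)"
    by (simp add: lessThan_Suc_atMost[symmetric])
  also have "(\<Sum>k<n. ?e (n - k) * esym n k x) = - (\<Sum>k<n. c k * esym n k x)"
    unfolding sum_negf[symmetric] by (intro sum.cong) (auto simp: appell_coeffs_def)
  also have "esym n n x = (\<Prod>i<n. x i)"
  proof -
    have "{S. S \<subseteq> {..<n} \<and> card S = n} = {{..<n}}"
      using card_subset_eq[of "{..<n}"] by auto
    then show ?thesis by (simp add: esym_def)
  qed
  finally show "f_sigma n c x = polarization ?e {..<n} x"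
    by (simp add: f_sigma_def)
qed

lemma higher_pderiv_appell_poly:
  assumes "k \<le> n"
  obtains a where "a \<noteq> 0" "(pderiv ^^ k) (appell_poly e n) = smult a (appell_poly e (n - k))"
  using assms
proof (induction k arbitrary: thesis)
  case 0
  show ?case by (rule 0(1)[of 1]) auto
next
  case (Suc k)
  obtain a where a: "a \<noteq> 0" "(pderiv ^^ k) (appell_poly e n) = smult a (appell_poly e (n - k))"
    using Suc by auto
  have nk: "n - k = Suc (n - Suc k)" using Suc.prems by simp
  show ?case
  proof (rule Suc.prems(1))
    show "(pderiv ^^ Suc k) (appell_poly e n) = smult (a * real (n - k)) (appell_poly e (n - Suc k))"
      by (simp add: a(2) pderiv_smult) (simp add: nk pderiv_appell_poly del: of_nat_Suc)
    show "a * real (n - k) \<noteq> 0" using a(1) nk by simp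
  qed
qed

lemma right_noetherian_iff:
  assumes "e 0 = 1"
  shows "right_noetherian (appell_poly e n) \<longleftrightarrow> noetherian_chain e n"
proof -
  have root: "poly ((pderiv ^^ k) (appell_poly e n)) x = 0 \<longleftrightarrow> poly (appell_poly e (n - k)) x = 0"
    if "k \<le> n" for k x
    by (rule higher_pderiv_appell_poly[OF that, of e]) simp
  have step: "(\<exists>x y. poly ((pderiv ^^ k) (appell_poly e n)) x = 0 \<and>
               is_largest_root ((pderiv ^^ (k + 1)) (appell_poly e n)) y \<and> x \<ge> y)
     \<longleftrightarrow> (\<exists>x y. poly (appell_poly e (Suc (n - k - 1))) x = 0 \<and>
               is_largest_root (appell_poly e (n - k - 1)) y \<and> x \<ge> y)" if "k + 2 \<le> n" for k
  proof -
    have "Suc (n - k - 1) = n - k" using that by simp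
    then show ?thesis
      using that root[of k] root[of "k + 1"] by (simp add: is_largest_root_def del: funpow.simps)
  qed
  have deg: "degree (appell_poly e n) = n" using assms by (simp add: degree_appell_poly)
  show ?thesis
  proof
    assume R: "right_noetherian (appell_poly e n)"
    show "noetherian_chain e n"
      unfolding noetherian_chain_def
    proof (intro allI impI)
      \<comment> \<open>The derivative of order \<open>k\<close> is proportional to the Appell polynomial of degree \<open>n - k\<close>, so the
        step from degree \<open>m\<close> to \<open>m + 1\<close> is the condition for \<open>k = n - m - 1\<close>.\<close>
      fix m assume m: "1 \<le> m \<and> m < n"
      then have k: "n - m - 1 + 2 \<le> n" "n - (n - m - 1) - 1 = m" by auto
      then show "\<exists>x y. poly (appell_poly e (Suc m)) x = 0 \<and> is_largest_root (appell_poly e m) y \<and> y \<le> x"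
        using step[OF k(1)] R unfolding right_noetherian_def deg k(2) by blast
    qed
  next
    assume N: "noetherian_chain e n"
    show "right_noetherian (appell_poly e n)"
      unfolding right_noetherian_def deg
    proof (intro allI impI)
      fix k assume k: "k + 2 \<le> n"
      then have "1 \<le> n - k - 1 \<and> n - k - 1 < n" by auto
      then show "\<exists>x y. poly ((pderiv ^^ k) (appell_poly e n)) x = 0 \<and>
               is_largest_root ((pderiv ^^ (k + 1)) (appell_poly e n)) y \<and> x \<ge> y"
        using N unfolding step[OF k] noetherian_chain_def by blast
    qed
  qed
qed

lemma strictly_right_noetherian_iff:
  assumes "e 0 = 1" "n \<ge> 1"
  shows "strictly_right_noetherian (appell_poly e n) \<longleftrightarrow> noetherian_chain e n \<and>
    (\<exists>x y. is_largest_root (appell_poly e n) x \<and> is_largest_root (appell_poly e (n - 1)) y \<and> x > y)"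
proof -
  have "is_largest_root (pderiv (appell_poly e n)) y \<longleftrightarrow> is_largest_root (appell_poly e (n - 1)) y" for y
    using pderiv_appell_poly[of e "n - 1"] assms(2) by (simp add: is_largest_root_def)
  then show ?thesis
    unfolding strictly_right_noetherian_def right_noetherian_iff[of e n, OF assms(1)] by simp
qed

theorem theorem1p2:
  fixes n :: nat and c :: "nat \<Rightarrow> real"
  assumes "n \<ge> 2"
  shows "(\<forall>t. poly (diag_restriction n c) t = f_sigma n c (diag_point n t)) \<and>
    ((\<exists>G \<in> positive_components n (f_sigma n c). upsilon_stable n G) \<longleftrightarrow>
       right_noetherian (diag_restriction n c)) \<and>
    ((\<exists>G \<in> positive_components n (f_sigma n c). strictly_upsilon_stable n G) \<longleftrightarrow>
       strictly_right_noetherian (diag_restriction n c)) \<and>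
    (\<forall>G \<in> positive_components n (f_sigma n c). upsilon_stable n G \<longrightarrow>
       (strictly_upsilon_stable n G \<longleftrightarrow> strictly_right_noetherian (diag_restriction n c)))"
proof -
  define e where "e = appell_coeffs n c"
  have e: "e 0 = 1" by (simp add: e_def)
  let ?G = "stable_component n e" and ?P = "positive_components n (f_sigma n c)"
  have P: "?P = components (topspace (Euclidean_space n) \<inter> {x. polarization e {..<n} x > 0})"
    by (simp add: positive_components_eq f_sigma_eq e_def)
  have unique: "G = ?G" if "G \<in> ?P" "upsilon_stable n G" for G
    using upsilon_stable_component_eq[of e, OF e] that unfolding P by blast
  have exists: "?G \<in> ?P \<longleftrightarrow> noetherian_chain e n"
    unfolding P noetherian_chain_iff[of e n, OF e]
    using stable_component_in_components[of n e] stable_component_vanishes_on_boundary[of e n] e assms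
    by auto
  have strict: "strictly_upsilon_stable n ?G \<longleftrightarrow> strictly_right_noetherian (diag_restriction n c)"
    if "?G \<in> ?P"
  proof -
    have "noetherian_chain e n" using that exists by simp
    then show ?thesis
      using frontier_subset_upsilon_1_iff[of n e, OF assms e] upsilon_stable_stable_component[of e n, OF e]
        strictly_right_noetherian_iff[of e n, OF e] assms
      unfolding strictly_upsilon_stable_def diag_restriction_eq e_def[symmetric]
      by (simp add: noetherian_chain_iff[of e, OF e])
  qed
  have weak: "right_noetherian (diag_restriction n c) \<longleftrightarrow> noetherian_chain e n"
    using right_noetherian_iff[of e n, OF e] by (simp add: diag_restriction_eq e_def)
  have diag: "poly (diag_restriction n c) t = f_sigma n c (diag_point n t)" for t
  proof -
    have "polarization e {..<n} (diag_point n t) = polarization e {..<n} (\<lambda>i. t)"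
      by (rule polarization_cong) (simp add: diag_point_def)
    then show ?thesis
      by (simp add: diag_restriction_eq f_sigma_eq polarization_diagonal flip: e_def)
  qed
  have stable: "(\<exists>G\<in>?P. upsilon_stable n G) \<longleftrightarrow> ?G \<in> ?P"
    using unique upsilon_stable_stable_component[of e n, OF e] by blast
  have "strictly_right_noetherian (diag_restriction n c) \<Longrightarrow> ?G \<in> ?P"
    using weak exists by (simp add: strictly_right_noetherian_def)
  then have "(\<exists>G\<in>?P. strictly_upsilon_stable n G) \<longleftrightarrow> strictly_right_noetherian (diag_restriction n c)"
    using unique strict unfolding strictly_upsilon_stable_def by blast
  then show ?thesis
    using diag stable weak exists unique strict by blast
qed

end
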